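(* Let $C,C_1,C_2,\ldots$ be bivariate Archimedean copulas with generators $\varphi,\varphi_1,\varphi_2,\ldots$, respectively (each right-continuous at $0$ and normalized to take the value $1$ at $\frac12$). Then the following conditions are equivalent: (a) $\lim_{n\to\infty}C_n(x,y)=C(x,y)$ for all $x,y\in[0,1]$; (b) $\lim_{n\to\infty}F_n^{\mathrm{Kendall}}(x)=F^{\mathrm{Kendall}}(x)$ for all $x\in\mathrm{Cont}(D^+\varphi)$; (c) $\lim_{n\to\infty}\varphi_n(x)=\varphi(x)$ for all $x\in(0,1]$; (d) $\lim_{n\to\infty}D^+\varphi_n(x)=D^+\varphi(x)$ for all $x\in\mathrm{Cont}(D^+\varphi)$.
   Context: A generator is a convex and strictly decreasing function $\varphi:[0,1]\to[0,\infty]$ with $\varphi(1)=0$. Throughout, all generators are assumed to be right-continuous at $0$, i.e. $\varphi(0)=\varphi(0+):=\lim_{t\to0^+}\varphi(t)$, and normalized so that $\varphi(\frac12)=1$. The Archimedean copula induced by $\varphi$ is $C(x,y)=\varphi^{-}(\varphi(x)+\varphi(y))$, $x,y\in[0,1]$, where $\varphi^{-}:[0,\infty]\to[0,1]$ is the pseudoinverse: $\varphi^{-}(x)=\varphi^{-1}(x)$ for $x\in[0,\varphi(0+))$ and $\varphi^{-}(x)=0$ for $x\ge\varphi(0+)$. $D^+\varphi(x)$ denotes the right-hand derivative of $\varphi$ at $x\in(0,1)$, and $\mathrm{Cont}(D^+\varphi)\subseteq(0,1)$ denotes the set of all continuity points of $D^+\varphi$ in $(0,1)$ (by definition $0$ and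 $1$ are not included). $F^{\mathrm{Kendall}}$ and $F_n^{\mathrm{Kendall}}$ denote the Kendall distribution functions of $C$ and $C_n$, respectively; for an Archimedean copula with generator $\varphi$ the Kendall distribution function (the distribution function of $C(X,Y)$ for $(X,Y)\sim C$) is given on $(0,1)$ by $F^{\mathrm{Kendall}}(x)=x-\frac{\varphi(x)}{D^+\varphi(x)}$. *)

theory Defs
  imports "HOL-Probability.Probability"
begin

text \<open>
  Generators are functions on the closed unit interval with values in \<open>[0, \<infinity>]\<close>; their values at
  arguments outside \<open>{0..1}\<close> are irrelevant. In \<^typ>\<open>ennreal\<close> we have \<open>0 * \<infinity> = 0\<close>, so the convexity
  inequality is trivial at \<open>u \<in> {0, 1}\<close> even if \<open>\<phi> 0 = \<infinity>\<close>. The last two conjuncts are the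
  standing assumptions of right-continuity at 0 and normalization.
\<close>

definition generator :: "(real \<Rightarrow> ennreal) \<Rightarrow> bool" where
  "generator \<phi> \<longleftrightarrow>
     (\<forall>x\<in>{0..1}. \<forall>y\<in>{0..1}. \<forall>u\<in>{0..1}.
        \<phi> (u * x + (1 - u) * y) \<le> ennreal u * \<phi> x + ennreal (1 - u) * \<phi> y) \<and>
     strict_antimono_on {0..1} \<phi> \<and>
     \<phi> 1 = 0 \<and>
     (\<phi> \<longlongrightarrow> \<phi> 0) (at_right 0) \<and>
     \<phi> (1 / 2) = 1"

definition pseudoinverse :: "(real \<Rightarrow> ennreal) \<Rightarrow> ennreal \<Rightarrow> real" where
  "pseudoinverse \<phi> z = (if z < Lim (at_right 0) \<phi> then inv_into {0..1} \<phi> z else 0)"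

definition archimedean_copula :: "(real \<Rightarrow> ennreal) \<Rightarrow> real \<Rightarrow> real \<Rightarrow> real" where
  "archimedean_copula \<phi> x y = pseudoinverse \<phi> (\<phi> x + \<phi> y)"

text \<open>
  The law of a pair \<open>(X, Y)\<close> with joint distribution function \<open>C\<close>, as a probability measure on the
  unit square. It is unique because the rectangles \<open>{0..x} \<times> {0..y}\<close> generate the Borel sets of the
  square.
\<close>

definition copula_measure :: "(real \<Rightarrow> real \<Rightarrow> real) \<Rightarrow> (real \<times> real) measure" where
  "copula_measure C = (THE M. prob_space M \<and>
     sets M = sets (restrict_space borel ({0..1} \<times> {0..1})) \<and>
     (\<forall>x\<in>{0..1}. \<forall>y\<in>{0..1}. measure M ({0..x} \<times> {0..y}) = C x y))"

definition kendall :: "(real \<Rightarrow> real \<Rightarrow> real) \<Rightarrow> real \<Rightarrow> real" where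
  "kendall C = cdf (distr (copula_measure C) borel (\<lambda>(x, y). C x y))"

text \<open>
  A generator is finite on \<open>{0<..1}\<close>, so passing to real values with \<^const>\<open>enn2real\<close> loses nothing
  at the points \<open>x \<in> {0<..<1}\<close> where the derivative is considered.
\<close>

definition right_deriv :: "(real \<Rightarrow> ennreal) \<Rightarrow> real \<Rightarrow> real" where
  "right_deriv \<phi> x =
     Lim (at_right x) (\<lambda>y. (enn2real (\<phi> y) - enn2real (\<phi> x)) / (y - x))"

definition cont_points :: "(real \<Rightarrow> real) \<Rightarrow> real set" where
  "cont_points f = {x \<in> {0<..<1}. isCont f x}"

end

theory Submission
  imports Defs
begin

text \<open>
  Write \<open>f\<close> for the real-valued version of a generator \<open>\<phi>\<close>, \<open>D\<close> for its right derivative and \<open>\<psi>\<close> for its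
  pseudoinverse. The convergence of copulas, of Kendall distribution functions and of derivatives is in each case compared with
  pointwise convergence of the functions \<open>f\<close> on \<open>(0, 1]\<close>.
  
  \<^bold>\<open>The Kendall distribution.\<close> Here a pair with joint distribution function \<open>C\<close> has to be produced.
  Let \<open>T\<close> have distribution function \<open>x - f x / D x\<close> on \<open>(0, 1)\<close>; this number is the zero of the tangent line
  at \<open>x\<close> with slope \<open>D x\<close>, so by convexity it increases with \<open>x\<close> and does not exceed 1. Let \<open>S\<close> be uniform and independent
  of \<open>T\<close>, and put \<open>X = \<psi> (\<phi> T * S)\<close> and \<open>Y = \<psi> (\<phi> T * (1 - S))\<close>. Then \<open>\<phi> X + \<phi> Y = \<phi> T\<close>, hence
  \<open>C X Y = T\<close>, and \<open>C X Y\<close> has the claimed law (\<open>kendall_eq_tangent_zero\<close>) as soon as \<open>C\<close> is the distribution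
  function of \<open>(X, Y)\<close>. Given \<open>T\<close>, the event \<open>X \<le> x \<and> Y \<le> y\<close> says that \<open>S\<close> lies in an interval of length
  \<open>1 - (f x + f y) / f T\<close>, cut off at 0. With \<open>f c = f x + f y\<close> the expectation of this length is \<open>c\<close>
  (\<open>expectation_truncated\<close>): write \<open>1 - f c / f T\<close> as \<open>f c\<close> times the integral of \<open>(1 / f)' = - D / f\<^sup>2\<close> over
  \<open>(T, c]\<close>, exchange the integrals, and observe that \<open>(1 / f)' s * (s - f s / D s)\<close> is the derivative of \<open>s / f s\<close>.
  
  \<^bold>\<open>Derivatives.\<close> If \<open>f\<^sub>n\<close> converges to \<open>f\<close>, then chords to the right and left of a continuity point of \<open>D\<close> enclose the
  derivatives, which therefore converge, and with them the Kendall functions. Conversely \<open>f\<close> is recovered from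
  \<open>D\<close> by integrating up to the point 1, where all generators vanish, and from the Kendall function \<open>K\<close> by integrating
  \<open>(ln f)' s = - 1 / (K s - s)\<close> from 1/2, where all generators are 1. Both integrals converge by dominated convergence.
  
  \<^bold>\<open>Copulas.\<close> Whether \<open>f s + f y < f t\<close> or \<open>f t < f s + f y\<close> is a matter of comparing \<open>t\<close> with \<open>C s y\<close>. So convergence
  of the generators gives convergence of the copulas directly. In the other direction strict inequalities between
  multiples \<open>k * f y\<close> and values \<open>f t\<close> carry over from the limit to the sequence, by induction on \<open>k\<close>. Using a point
  \<open>y\<close> with small \<open>f y\<close> as a measuring rod for both \<open>f (1/2) = 1\<close> and \<open>f x\<close> encloses \<open>f\<^sub>n x\<close>
  (\<open>C_converges_imp_sandwich\<close>).
\<close>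

section \<open>Integration along right derivatives\<close>

text \<open>
  For a Lipschitz function the difference quotients with step \<open>c\<close> are bounded by the Lipschitz constant and tend to the right
  derivative at every interior point. Their integrals are differences of averages of \<open>H\<close> over intervals of length \<open>c\<close> at \<open>b\<close> and at
  \<open>a\<close>, so dominated convergence yields the fundamental theorem. One-sided derivatives suffice, which suits
  convex functions: they have right derivatives everywhere, but may fail to be differentiable on a dense set.
\<close>

lemma FTC_right_derivative:
  fixes H h :: "real \<Rightarrow> real"
  assumes ab: "a < b"
    and lip: "\<And>x y. x \<in> {a..b} \<Longrightarrow> y \<in> {a..b} \<Longrightarrow> \<bar>H y - H x\<bar> \<le> L * \<bar>y - x\<bar>"
    and der: "\<And>x. x \<in> {a<..<b} \<Longrightarrow> (H has_real_derivative h x) (at_right x)"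
  shows "(h has_integral H b - H a) {a..b}"
proof -
  \<comment> \<open>Constant extension beyond the interval, which keeps the Lipschitz bound valid for shifted arguments.\<close>
  define K where "K x = H (max a (min x b))" for x
  define c where "c n = 1 / real (Suc n)" for n
  have c: "c n > 0" for n by (simp add: c_def)
  have L: "0 \<le> L" using lip[of a b] ab by (simp add: zero_le_mult_iff abs_le_iff)
      (smt (verit) mult_neg_pos)
  have K_lip: "\<bar>K y - K x\<bar> \<le> L * \<bar>y - x\<bar>" for x y
  proof -
    have "\<bar>K y - K x\<bar> \<le> L * \<bar>max a (min y b) - max a (min x b)\<bar>"
      unfolding K_def using ab by (intro lip) auto
    also have "\<dots> \<le> L * \<bar>y - x\<bar>"
      by (intro mult_left_mono L) auto
    finally show ?thesis .
  qed
  have K_cont: "continuous_on S K" for S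
    by (rule lipschitz_on_continuous_on[OF lipschitz_onI[of _ _ L]])
      (use K_lip L in \<open>auto simp: dist_real_def abs_minus_commute\<close>)
  have K_int: "K integrable_on {u..v}" for u v
    by (intro integrable_continuous_real K_cont)
  let ?I = "\<lambda>u v. integral {u..v} K"
  define q where "q n x = (K (x + c n) - K x) / c n" for n x
  define y where "y n = (?I b (b + c n) - ?I a (a + c n)) / c n" for n
  have q_int: "(q n has_integral y n) {a..b}" for n
  proof -
    have "(K has_integral ?I (a + c n) (b + c n)) {a + c n..b + c n}"
      by (intro integrable_integral K_int)
    then have "((\<lambda>x. K (x + c n)) has_integral ?I (a + c n) (b + c n)) {a..b}"
      using has_integral_affinity[of K _ "a + c n" "b + c n" 1 "c n"] by (simp add: algebra_simps)
    then have "(q n has_integral (?I (a + c n) (b + c n) - ?I a b) / c n) {a..b}"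
      unfolding q_def by (intro has_integral_divide has_integral_diff integrable_integral K_int)
    moreover have "?I a (a + c n) + ?I (a + c n) (b + c n) = ?I a b + ?I b (b + c n)"
      using Henstock_Kurzweil_Integration.integral_combine[OF _ _ K_int[of a "b + c n"], of "a + c n"]
        Henstock_Kurzweil_Integration.integral_combine[OF _ _ K_int[of a "b + c n"], of b] ab c[of n] by linarith
    then have "?I (a + c n) (b + c n) - ?I a b = ?I b (b + c n) - ?I a (a + c n)" by linarith
    ultimately show ?thesis unfolding y_def by simp
  qed
  \<comment> \<open>Averages over short intervals converge to the value at the left end point.\<close>
  have near: "\<bar>?I u (u + c n) / c n - K u\<bar> \<le> L * c n" for u n
  proof -
    have i: "((\<lambda>x. K x - K u) has_integral ?I u (u + c n) - K u * c n) {u..u + c n}"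
      using has_integral_diff[OF integrable_integral[OF K_int[of u "u + c n"]] has_integral_const_real[of "K u" u "u + c n"]]
        c[of n] by (simp add: mult.commute)
    have "norm (?I u (u + c n) - K u * c n) \<le> (L * c n) * measure lborel {u..u + c n}"
    proof (rule has_integral_bound_real[OF _ finite.emptyI i])
      show "0 \<le> L * c n" using L c[of n] by simp
      show "norm (K x - K u) \<le> L * c n" if "x \<in> {u..u + c n} - {}" for x
      proof -
        have "\<bar>K x - K u\<bar> \<le> L * \<bar>x - u\<bar>" by (rule K_lip)
        also have "\<dots> \<le> L * c n" using that L by (intro mult_left_mono) auto
        finally show ?thesis by simp
      qed
    qed
    moreover have "?I u (u + c n) / c n - K u = (?I u (u + c n) - K u * c n) / c n"
      using c[of n] by (simp add: field_simps)
    ultimately show ?thesis using c[of n] by (simp add: abs_divide pos_divide_le_eq)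
  qed
  have c0: "c \<longlonglongrightarrow> 0"
    unfolding c_def using LIMSEQ_inverse_real_of_nat by (simp add: inverse_eq_divide)
  have lim: "(\<lambda>n. ?I u (u + c n) / c n) \<longlonglongrightarrow> K u" for u
  proof (rule LIM_zero_cancel, rule Lim_null_comparison)
    show "eventually (\<lambda>n. norm (?I u (u + c n) / c n - K u) \<le> L * c n) sequentially"
      using near by simp
    show "(\<lambda>n. L * c n) \<longlonglongrightarrow> 0" using tendsto_mult_right_zero[OF c0] by simp
  qed
  have y: "y \<longlonglongrightarrow> H b - H a"
    using tendsto_diff[OF lim[of b] lim[of a]] ab by (simp add: y_def[abs_def] K_def diff_divide_distrib)
  let ?h = "\<lambda>x. if x \<in> {a<..<b} then h x else 0"
  have "(?h has_integral H b - H a) {a..b}"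
  proof (rule has_integral_dominated_convergence[OF _ _ _ _ y])
    show "((\<lambda>x. if x \<in> {a<..<b} then q n x else 0) has_integral y n) {a..b}" for n
      by (rule has_integral_spike_finite[of "{a, b}", OF _ _ q_int]) auto
    show "(\<lambda>x. L) integrable_on {a..b}" by (rule integrable_const_ivl)
    show "\<forall>x\<in>{a..b}. norm (if x \<in> {a<..<b} then q n x else 0) \<le> L" for n
      using K_lip[of "_ + c n"] c[of n] L by (auto simp: q_def abs_divide pos_divide_le_eq) 
        (metis abs_of_pos add_diff_cancel_left' c)
    show "\<forall>x\<in>{a..b}. (\<lambda>n. if x \<in> {a<..<b} then q n x else 0) \<longlonglongrightarrow> ?h x"
    proof
      fix x assume "x \<in> {a..b}"
      show "(\<lambda>n. if x \<in> {a<..<b} then q n x else 0) \<longlonglongrightarrow> ?h x"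
      proof (cases "x \<in> {a<..<b}")
        case True
        have f: "filterlim (\<lambda>n. x + c n) (at_right x) sequentially"
          using tendsto_add[OF tendsto_const[of x] c0] c by (auto simp: filterlim_at order_less_imp_not_eq2)
        have "((\<lambda>y. (H y - H x) / (y - x)) \<longlongrightarrow> h x) (at_right x)"
          using der[OF True] by (simp add: has_field_derivative_iff)
        from filterlim_compose[OF this f]
        have *: "(\<lambda>n. (H (x + c n) - H x) / c n) \<longlonglongrightarrow> h x" by simp
        have "eventually (\<lambda>n. x + c n < b) sequentially"
          by (rule order_tendstoD[OF tendsto_add[OF tendsto_const[of x] c0]]) (use True in auto)
        then have "eventually (\<lambda>n. (H (x + c n) - H x) / c n = q n x) sequentially"
        proof eventually_elim
          case (elim n)
          then show ?case using True c[of n] by (simp add: q_def K_def min_def max_def)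
        qed
        from tendsto_cong[THEN iffD1, OF this *] show ?thesis using True by simp
      qed auto
    qed
  qed
  then show ?thesis
    by (rule has_integral_spike_finite[of "{a, b}", rotated 2]) auto
qed

text \<open>
  Increments of primitives converge when the integrands do, off a countable set; applied to the derivatives of the generators
  and of their logarithms.
\<close>

lemma bounded_convergence_increments:
  fixes g :: "nat \<Rightarrow> real \<Rightarrow> real"
  assumes int: "\<And>n. (g n has_integral y n) {a..b}" "(g' has_integral y') {a..b}"
    and S: "countable S"
    and conv: "\<And>x. x \<in> {a<..<b} - S \<Longrightarrow> (\<lambda>n. g n x) \<longlonglongrightarrow> g' x"
    and bnd: "eventually (\<lambda>n. \<forall>x\<in>{a<..<b}. \<bar>g n x\<bar> \<le> B) sequentially"
  shows "y \<longlonglongrightarrow> y'"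
proof -
  obtain N where N: "\<And>n x. n \<ge> N \<Longrightarrow> x \<in> {a<..<b} \<Longrightarrow> \<bar>g n x\<bar> \<le> B"
    using bnd unfolding eventually_sequentially by blast
  let ?T = "{a<..<b} - S"
  have "negligible (\<Union>((\<lambda>s. {s}) ` ({a, b} \<union> S)))" using S by (intro negligible_countable_Union) auto
  then have neg: "negligible ({a, b} \<union> S)" by (simp only: UN_singleton)
  have i: "((\<lambda>x. if x \<in> ?T then g n x else 0) has_integral y n) {a..b}" for n
    by (rule has_integral_spike[OF neg _ int(1)]) auto
  have i': "((\<lambda>x. if x \<in> ?T then g' x else 0) has_integral y') {a..b}"
    by (rule has_integral_spike[OF neg _ int(2)]) auto
  have "(\<lambda>n. integral {a..b} (\<lambda>x. if x \<in> ?T then g (n + N) x else 0)) \<longlonglongrightarrow>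
      integral {a..b} (\<lambda>x. if x \<in> ?T then g' x else 0)"
  proof (rule dominated_convergence(2))
    show "(\<lambda>x. if x \<in> ?T then g (n + N) x else 0) integrable_on {a..b}" for n
      using i by blast
    show "(\<lambda>x. \<bar>B\<bar>) integrable_on {a..b}" by (rule integrable_const_ivl)
    show "norm (if x \<in> ?T then g (n + N) x else 0) \<le> \<bar>B\<bar>" for n x
      using N[of "n + N" x] by auto
    show "(\<lambda>n. if x \<in> ?T then g (n + N) x else 0) \<longlonglongrightarrow> (if x \<in> ?T then g' x else 0)" for x
      using LIMSEQ_ignore_initial_segment[OF conv, of x N] by auto
  qed
  then have "(\<lambda>n. y (n + N)) \<longlonglongrightarrow> y'"
    using integral_unique[OF i] integral_unique[OF i'] by simp
  then show ?thesis by (rule LIMSEQ_offset)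
qed

text \<open>
  Monotone convergence extends the fundamental theorem to an interval at whose left end the integrand may be
  unbounded. It is needed at 0, where a generator can be infinite.
\<close>

lemma nn_integral_increment_half_open:
  fixes H h :: "real \<Rightarrow> real"
  assumes ac: "a < c"
    and meas: "h \<in> borel_measurable borel"
    and nonneg: "\<And>s. a < s \<Longrightarrow> s \<le> c \<Longrightarrow> 0 \<le> h s"
    and int: "\<And>t. a < t \<Longrightarrow> t < c \<Longrightarrow> (h has_integral H c - H t) {t..c}"
    and lim: "(H \<longlongrightarrow> l) (at_right a)"
  shows "(\<integral>\<^sup>+s. ennreal (h s) * indicator {a<..c} s \<partial>lborel) = ennreal (H c - l)"
proof -
  define t where "t n = a + (c - a) / real (Suc (Suc n))" for n
  have t: "a < t n" "t n < c" for n
  proof -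
    have "(c - a) / real (Suc (Suc n)) < (c - a) / 1"
      using ac by (intro divide_strict_left_mono) auto
    then show "a < t n" "t n < c" using ac by (simp_all add: t_def)
  qed
  have t_dec: "t n \<le> t m" if "m \<le> n" for m n
    using ac that by (auto simp: t_def intro!: divide_left_mono)
  have t_lim: "t \<longlonglongrightarrow> a"
    unfolding t_def by real_asymp
  let ?f = "\<lambda>n s. ennreal (h s) * indicator {t n..c} s"
  have 1: "(\<lambda>n. \<integral>\<^sup>+s. ?f n s \<partial>lborel) \<longlonglongrightarrow> (\<integral>\<^sup>+s. ennreal (h s) * indicator {a<..c} s \<partial>lborel)"
  proof (rule nn_integral_LIMSEQ)
    show "incseq ?f"
    proof (rule incseq_SucI, rule le_funI)
      fix n s
      show "?f n s \<le> ?f (Suc n) s"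
        using t_dec[of n "Suc n"] by (intro mult_left_mono) (simp_all add: indicator_def)
    qed
    show "?f n \<in> borel_measurable lborel" for n using meas by simp
    show "(\<lambda>n. ?f n s) \<longlonglongrightarrow> ennreal (h s) * indicator {a<..c} s" for s
    proof (cases "a < s")
      case True
      have "eventually (\<lambda>n. t n < s) sequentially" using order_tendstoD(2)[OF t_lim True] .
      then have "eventually (\<lambda>n. ?f n s = ennreal (h s) * indicator {a<..c} s) sequentially"
        by eventually_elim (use True in \<open>auto simp: indicator_def\<close>)
      then show ?thesis by (rule tendsto_eventually)
    next
      case False
      then have "?f n s = ennreal (h s) * indicator {a<..c} s" for n
        using t(1)[of n] by (auto simp: indicator_def)
      then show ?thesis by simp
    qed
  qed
  have 2: "(\<integral>\<^sup>+s. ?f n s \<partial>lborel) = ennreal (H c - H (t n))" for n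
  proof (rule nn_integral_has_integral_lebesgue')
    show "0 \<le> h s" if "s \<in> {t n..c}" for s using nonneg[of s] that t(1)[of n] by simp
    show "(h has_integral H c - H (t n)) {t n..c}" using int t by simp
  qed
  have 3: "(\<lambda>n. ennreal (H c - H (t n))) \<longlonglongrightarrow> ennreal (H c - l)"
  proof -
    have "filterlim t (at_right a) sequentially"
      using t_lim t by (auto simp: filterlim_at order_less_imp_not_eq2)
    from filterlim_compose[OF lim this] show ?thesis by (intro tendsto_intros)
  qed
  show ?thesis using LIMSEQ_unique[OF 1[unfolded 2] 3] .
qed

section \<open>Measures on the unit square\<close>

text \<open>
  Transported to the plane, the two measures agree on all lower orthants \<open>{..a}\<close>, because an orthant meets the unit square in a
  rectangle anchored at the origin or not at all; the orthants are closed under intersection and generate the Borel sets.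
\<close>

lemma measure_unit_square_eqI:
  fixes M N :: "(real \<times> real) measure"
  assumes "prob_space M" "prob_space N"
    and M: "sets M = sets (restrict_space borel ({0..1} \<times> {0..1}))"
    and N: "sets N = sets (restrict_space borel ({0..1} \<times> {0..1}))"
    and eq: "\<And>x y. x \<in> {0..1} \<Longrightarrow> y \<in> {0..1} \<Longrightarrow> measure M ({0..x} \<times> {0..y}) = measure N ({0..x} \<times> {0..y})"
  shows "M = N"
proof -
  interpret M: prob_space M by fact
  interpret N: prob_space N by fact
  let ?Q = "{0..1} \<times> {0..1} :: (real \<times> real) set"
  have Q: "?Q \<in> sets borel" by (intro borel_closed closed_Times) auto
  have sets_eq: "sets (restrict_space borel ?Q) = {A \<in> sets borel. A \<subseteq> ?Q}"
    using Q by (auto simp: sets_restrict_space)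
  have id: "(\<lambda>x. x) \<in> measurable L borel" if "sets L = sets (restrict_space borel ?Q)" for L
    unfolding measurable_cong_sets[OF that refl] by (rule measurable_restrict_space1) simp
  have space: "space L = ?Q" if "sets L = sets (restrict_space borel ?Q)" for L
    using sets_eq_imp_space_eq[OF that] Q by (simp add: space_restrict_space)
  have d: "emeasure (distr L borel (\<lambda>x. x)) A = emeasure L (A \<inter> ?Q)"
    if "sets L = sets (restrict_space borel ?Q)" "A \<in> sets borel" for L A
    using that by (simp add: emeasure_distr id space vimage_def) 
  have "distr M borel (\<lambda>x. x) = distr N borel (\<lambda>x. x)"
  proof (rule measure_eqI_generator_eq[where \<Omega> = UNIV and E = "range (\<lambda>a. {..a})" and A = "\<lambda>n. {..(real n, real n)}"])
    show "Int_stable (range (\<lambda>a. {..a :: real \<times> real}))"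
    proof (rule Int_stableI_image)
      show "\<exists>k\<in>UNIV. {..i} \<inter> {..j} = {..k}" for i j :: "real \<times> real"
        by (rule bexI[of _ "inf i j"]) auto
    qed
    have b: "sets borel = sigma_sets UNIV (range (\<lambda>a. {..a :: real \<times> real}))"
      by (subst borel_eq_atMost) simp
    show "sets (distr M borel (\<lambda>x. x)) = sigma_sets UNIV (range (\<lambda>a. {..a}))"
      "sets (distr N borel (\<lambda>x. x)) = sigma_sets UNIV (range (\<lambda>a. {..a}))"
      using b by simp_all
    show "(\<Union>n. {..(real n, real n)}) = UNIV"
    proof (intro set_eqI iffI UNIV_I)
      fix z :: "real \<times> real"
      obtain n where "max (fst z) (snd z) \<le> real n" using real_arch_simple by blast
      then show "z \<in> (\<Union>n. {..(real n, real n)})" by (auto simp: less_eq_prod_def)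
    qed
    show "emeasure (distr M borel (\<lambda>x. x)) {..(real n, real n)} \<noteq> \<infinity>" for n
      by (simp add: d[OF M])
    fix X :: "(real \<times> real) set" assume "X \<in> range (\<lambda>a. {..a})"
    then obtain a b where X: "X = {..(a, b)}" by auto
    have "X \<inter> ?Q = (if a < 0 \<or> b < 0 then {} else {0..min a 1} \<times> {0..min b 1})"
      by (auto simp: X)
    moreover have "measure M ({0..min a 1} \<times> {0..min b 1}) = measure N ({0..min a 1} \<times> {0..min b 1})" if "0 \<le> a" "0 \<le> b"
      using that by (intro eq) auto
    ultimately show "emeasure (distr M borel (\<lambda>x. x)) X = emeasure (distr N borel (\<lambda>x. x)) X"
      by (simp add: X d[OF M] d[OF N] M.emeasure_eq_measure N.emeasure_eq_measure)
  qed auto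
  then have "emeasure M (A \<inter> ?Q) = emeasure N (A \<inter> ?Q)" if "A \<in> sets borel" for A
    using d[OF M that] d[OF N that] by simp
  then have "emeasure M A = emeasure N A" if "A \<in> sets M" for A
    using that by (metis (no_types, lifting) M sets_eq inf.absorb1 mem_Collect_eq)
  then show ?thesis using M N by (intro measure_eqI) auto
qed

section \<open>Generators and their pseudoinverses\<close>

text \<open>
  Finite values of a generator are treated as reals, through \<open>f\<close>. At 0 the value \<open>\<infinity>\<close> becomes \<open>f 0 = 0\<close>, so that
  \<open>1 / f 0 = 0\<close> is the correct limit of \<open>1 / f\<close> at 0 in both cases.
\<close>

locale archimedean_generator =
  fixes \<phi> :: "real \<Rightarrow> ennreal"
  assumes gen: "generator \<phi>"
begin

definition f :: "real \<Rightarrow> real" where "f x = enn2real (\<phi> x)"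

abbreviation D :: "real \<Rightarrow> real" where "D \<equiv> right_deriv \<phi>"

abbreviation \<psi> :: "ennreal \<Rightarrow> real" where "\<psi> \<equiv> pseudoinverse \<phi>"

lemma phi_strict: "x \<in> {0..1} \<Longrightarrow> y \<in> {0..1} \<Longrightarrow> x < y \<Longrightarrow> \<phi> y < \<phi> x"
  using gen unfolding generator_def monotone_on_def by blast

lemma phi_1: "\<phi> 1 = 0" and phi_half: "\<phi> (1/2) = 1" and phi_tendsto_0: "(\<phi> \<longlongrightarrow> \<phi> 0) (at_right 0)"
  using gen unfolding generator_def by auto

lemma phi_less_iff: "x \<in> {0..1} \<Longrightarrow> y \<in> {0..1} \<Longrightarrow> \<phi> x < \<phi> y \<longleftrightarrow> y < x"
  using phi_strict[of x y] phi_strict[of y x] by (metis less_asym linorder_neqE)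

lemma phi_le_iff: "x \<in> {0..1} \<Longrightarrow> y \<in> {0..1} \<Longrightarrow> \<phi> x \<le> \<phi> y \<longleftrightarrow> y \<le> x"
  using phi_less_iff[of y x] by (simp add: not_less[symmetric])

lemma phi_finite: "0 < x \<Longrightarrow> x \<le> 1 \<Longrightarrow> \<phi> x < top"
  using phi_strict[of 0 x] using top.not_eq_extremum by fastforce

lemma phi_eq_f: "0 < x \<Longrightarrow> x \<le> 1 \<Longrightarrow> \<phi> x = ennreal (f x)"
  unfolding f_def using phi_finite by (simp add: less_top)

lemma f_nonneg [simp]: "0 \<le> f x"
  by (simp add: f_def)

lemma f_1: "f 1 = 0" and f_half: "f (1/2) = 1"
  by (simp_all add: f_def phi_1 phi_half)

lemma f_strict: "0 < x \<Longrightarrow> x < y \<Longrightarrow> y \<le> 1 \<Longrightarrow> f y < f x"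
  using phi_strict[of x y] phi_eq_f[of x] phi_eq_f[of y] by (simp add: ennreal_less_iff)

lemma f_antimono: "0 < x \<Longrightarrow> x \<le> y \<Longrightarrow> y \<le> 1 \<Longrightarrow> f y \<le> f x"
  using f_strict[of x y] by (cases "x = y") auto

lemma f_less_iff: "0 < x \<Longrightarrow> x \<le> 1 \<Longrightarrow> 0 < y \<Longrightarrow> y \<le> 1 \<Longrightarrow> f x < f y \<longleftrightarrow> y < x"
  using f_strict[of x y] f_strict[of y x] by (metis less_asym linorder_neqE)

lemma f_pos: "0 < x \<Longrightarrow> x < 1 \<Longrightarrow> 0 < f x"
  using f_strict[of x 1] f_1 by simp

lemma f_convex: "convex_on {0<..1} f"
proof (rule convex_onI)
  fix u x y :: real
  assume u: "0 < u" "u < 1" and xy: "x \<in> {0<..1}" "y \<in> {0<..1}"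
  define w where "w = (1 - u) * x + u * y"
  have w: "0 < w" "w \<le> 1"
    using u xy convex_bound_le[of x 1 y "1 - u" u] by (auto simp: w_def intro!: add_pos_pos)
  have "1 - u \<in> {0..1}" "x \<in> {0..1}" "y \<in> {0..1}" using u xy by auto
  then have "\<phi> ((1 - u) * x + (1 - (1 - u)) * y) \<le> ennreal (1 - u) * \<phi> x + ennreal (1 - (1 - u)) * \<phi> y"
    using gen unfolding generator_def by blast
  moreover have "ennreal ((1 - u) * f x + u * f y) = ennreal (1 - u) * ennreal (f x) + ennreal u * ennreal (f y)"
    using u by (simp add: ennreal_mult)
  ultimately have "ennreal (f w) \<le> ennreal ((1 - u) * f x + u * f y)"
    using u xy w by (simp add: phi_eq_f w_def[symmetric])
  then have "f w \<le> (1 - u) * f x + u * f y"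
    using u by (subst (asm) ennreal_le_iff) auto
  then show "f ((1 - u) *\<^sub>R x + u *\<^sub>R y) \<le> (1 - u) * f x + u * f y"
    by (simp add: w_def)
qed (rule convex_real_interval)

definition slope :: "real \<Rightarrow> real \<Rightarrow> real" where "slope x y = (f y - f x) / (y - x)"

lemma slope_swap: "(f x - f y) / (x - y) = slope x y"
  unfolding slope_def by (metis minus_diff_eq minus_divide_divide)

lemma slope_left: "0 < x \<Longrightarrow> x < y \<Longrightarrow> y < z \<Longrightarrow> z \<le> 1 \<Longrightarrow> slope x y \<le> slope x z"
  and slope_right: "0 < x \<Longrightarrow> x < y \<Longrightarrow> y < z \<Longrightarrow> z \<le> 1 \<Longrightarrow> slope x z \<le> slope y z"
  using convex_on_slope_le[OF f_convex, of x z y]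
  by (simp_all add: slope_swap)

lemma slope_neg: "0 < x \<Longrightarrow> x < y \<Longrightarrow> y \<le> 1 \<Longrightarrow> slope x y < 0"
  using f_strict[of x y] by (simp add: slope_def divide_neg_pos)

lemma slope_chain: "0 < x \<Longrightarrow> x < y \<Longrightarrow> y \<le> x' \<Longrightarrow> x' < y' \<Longrightarrow> y' \<le> 1 \<Longrightarrow> slope x y \<le> slope x' y'"
proof -
  assume a: "0 < x" "x < y" "y \<le> x'" "x' < y'" "y' \<le> 1"
  have "slope x y \<le> slope x y'" using slope_left[of x y y'] a by simp
  also have "\<dots> \<le> slope x' y'" using slope_right[of x x' y'] a by simp
  finally show ?thesis .
qed

text \<open>
  Right of \<open>a\<close> all chord slopes lie between the slope over \<open>[a/2, a]\<close> and 0.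
\<close>

lemma f_lipschitz:
  assumes "0 < a" "a \<le> 1"
  obtains L where "0 \<le> L" "\<And>x y. a \<le> x \<Longrightarrow> x \<le> 1 \<Longrightarrow> a \<le> y \<Longrightarrow> y \<le> 1 \<Longrightarrow> \<bar>f y - f x\<bar> \<le> L * \<bar>y - x\<bar>"
proof
  \<comment> \<open>Bounds the steepness of all chords right of a.\<close>
  define L where "L = - slope (a/2) a"
  show "0 \<le> L" using slope_neg[of "a/2" a] assms by (simp add: L_def)
  have *: "\<bar>f y - f x\<bar> \<le> L * \<bar>y - x\<bar>" if "a \<le> x" "x < y" "y \<le> 1" for x y
  proof -
    have "- L \<le> slope x y" unfolding L_def using slope_chain[of "a/2" a x y] assms that by simp
    then show ?thesis using f_strict[of x y] that assms by (simp add: slope_def field_simps)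
  qed
  show "\<bar>f y - f x\<bar> \<le> L * \<bar>y - x\<bar>" if "a \<le> x" "x \<le> 1" "a \<le> y" "y \<le> 1" for x y
    using *[of x y] *[of y x] that by (cases x y rule: linorder_cases) (simp_all add: abs_minus_commute)
qed

lemma f_continuous: "continuous_on {0<..1} f"
proof (rule continuous_on_eq_continuous_within[THEN iffD2, rule_format])
  fix x :: real assume x: "x \<in> {0<..1}"
  obtain L where L: "0 \<le> L" "\<And>u v. x/2 \<le> u \<Longrightarrow> u \<le> 1 \<Longrightarrow> x/2 \<le> v \<Longrightarrow> v \<le> 1 \<Longrightarrow> \<bar>f v - f u\<bar> \<le> L * \<bar>v - u\<bar>"
    using f_lipschitz[of "x/2"] x by auto
  have "((\<lambda>y. f y - f x) \<longlongrightarrow> 0) (at x within {0<..1})"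
  proof (rule Lim_null_comparison)
    have "eventually (\<lambda>y. x/2 < y) (at x within {0<..1})"
      by (rule order_tendstoD[OF tendsto_ident_at]) (use x in auto)
    moreover have "eventually (\<lambda>y. y \<in> {0<..1}) (at x within {0<..1})"
      by (auto simp: eventually_at_filter)
    ultimately show "eventually (\<lambda>y. norm (f y - f x) \<le> L * \<bar>y - x\<bar>) (at x within {0<..1})"
      by eventually_elim (use x L(2)[of x] in auto)
    have "((\<lambda>y. L * \<bar>y - x\<bar>) \<longlongrightarrow> L * \<bar>x - x\<bar>) (at x within {0<..1})"
      by (intro tendsto_intros)
    then show "((\<lambda>y. L * \<bar>y - x\<bar>) \<longlongrightarrow> 0) (at x within {0<..1})" by simp
  qed
  then show "continuous (at x within {0<..1}) f"
    unfolding continuous_within by (rule LIM_zero_cancel)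
qed

lemma phi_continuous: "continuous_on {0..1} \<phi>"
proof (rule continuous_on_eq_continuous_within[THEN iffD2, rule_format])
  fix x :: real assume x: "x \<in> {0..1}"
  show "continuous (at x within {0..1}) \<phi>"
  proof (cases "x = 0")
    case True
    then show ?thesis unfolding continuous_within
      using phi_tendsto_0 by (simp add: at_within_Icc_at_right)
  next
    case False
    have "continuous_on {0<..1} (\<lambda>x. ennreal (f x))"
      using f_continuous by (intro continuous_on_ennreal)
    then have "continuous_on {0<..1} \<phi>"
      by (rule continuous_on_eq) (simp add: phi_eq_f)
    then have "continuous (at x within {0<..1}) \<phi>"
      using x False by (simp add: continuous_on_eq_continuous_within)
    moreover have "at x within {0..1} = at x within {0<..1}"
      by (rule at_within_nhd[of _ "{0<..}"]) (use x False in auto)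
    ultimately show ?thesis by (simp add: continuous_within)
  qed
qed

lemma phi_surj:
  assumes "z \<le> \<phi> 0"
  obtains t where "t \<in> {0..1}" "\<phi> t = z"
  using IVT2'[of \<phi> 1 z 0] assms phi_1 phi_continuous by auto

lemma phi_surj_pos:
  assumes "z < \<phi> 0"
  obtains t where "0 < t" "t \<le> 1" "\<phi> t = z"
  using phi_surj[of z] assms by (metis atLeastAtMost_iff less_eq_real_def less_imp_le less_irrefl)

lemma psi_phi: "t \<in> {0..1} \<Longrightarrow> \<psi> (\<phi> t) = t"
proof -
  assume t: "t \<in> {0..1}"
  have "inj_on \<phi> {0..1}"
    by (rule linorder_inj_onI') (metis phi_strict less_irrefl)
  then show ?thesis
    using t phi_less_iff[of t 0] unfolding pseudoinverse_def tendsto_Lim[OF trivial_limit_at_right_real phi_tendsto_0]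
    by (auto simp: inv_into_f_f)
qed

lemma psi_ge: "\<phi> 0 \<le> z \<Longrightarrow> \<psi> z = 0"
  unfolding pseudoinverse_def tendsto_Lim[OF trivial_limit_at_right_real phi_tendsto_0] by simp

lemma psi_cases:
  obtains t where "t \<in> {0..1}" "\<phi> t = min z (\<phi> 0)" "\<psi> z = t"
proof (cases "z \<le> \<phi> 0")
  case True
  then show ?thesis using phi_surj[of z] psi_phi that by (metis min.absorb1)
next
  case False
  then show ?thesis using psi_ge that[of 0] by simp
qed

lemma psi_range: "\<psi> z \<in> {0..1}" and phi_psi: "\<phi> (\<psi> z) = min z (\<phi> 0)"
  by (rule psi_cases[of z]; simp)+

text \<open>
  These two equivalences turn statements about \<open>\<psi>\<close> into comparisons of
  generator values, uniformly in whether \<open>\<phi> 0\<close> is finite. The second one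
  excludes \<open>t = 0\<close>, since \<open>0 \<le> \<psi> z\<close> also holds for \<open>z > \<phi> 0\<close>.
\<close>

lemma psi_le_iff: "x \<in> {0..1} \<Longrightarrow> \<psi> z \<le> x \<longleftrightarrow> \<phi> x \<le> z"
  using phi_le_iff[OF _ psi_range, of x z] phi_le_iff[of x 0] by (auto simp: phi_psi)

lemma le_psi_iff: "0 < t \<Longrightarrow> t \<le> 1 \<Longrightarrow> t \<le> \<psi> z \<longleftrightarrow> z \<le> \<phi> t"
  using phi_le_iff[OF psi_range, of t z] phi_less_iff[of t 0] by (auto simp: phi_psi min_le_iff_disj)

lemma copula_less_iff:
  assumes "s \<in> {0<..1}" "y \<in> {0<..1}" "t \<in> {0<..1}"
  shows "archimedean_copula \<phi> s y < t \<longleftrightarrow> f t < f s + f y"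
    and "t < archimedean_copula \<phi> s y \<longleftrightarrow> f s + f y < f t"
  using assms le_psi_iff[of t "\<phi> s + \<phi> y"] psi_le_iff[of t "\<phi> s + \<phi> y"]
  by (auto simp: archimedean_copula_def not_le[symmetric] phi_eq_f ennreal_plus[symmetric] simp del: ennreal_plus)

lemma copula_0: "archimedean_copula \<phi> 0 y = 0" "archimedean_copula \<phi> x 0 = 0"
  by (simp_all add: archimedean_copula_def psi_ge)

lemma copula_range: "archimedean_copula \<phi> x y \<in> {0..1}"
  using psi_range by (simp add: archimedean_copula_def)

section \<open>Right derivatives and tangent lines\<close>

text \<open>
  Chord slopes from \<open>x\<close> decrease as the right end point approaches \<open>x\<close> and are bounded below by the slopes of chords
  ending in \<open>x\<close>; the right derivative is their infimum.
\<close>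

lemma slope_tendsto: "0 < x \<Longrightarrow> x < 1 \<Longrightarrow> (slope x \<longlongrightarrow> D x) (at_right x)"
  and D_le_slope: "0 < x \<Longrightarrow> x < y \<Longrightarrow> y \<le> 1 \<Longrightarrow> D x \<le> slope x y"
  and slope_le_D: "0 < w \<Longrightarrow> w < x \<Longrightarrow> x < 1 \<Longrightarrow> slope w x \<le> D x"
proof -
  have *: "(slope x \<longlongrightarrow> D x) (at_right x) \<and> (\<forall>y. x < y \<longrightarrow> y \<le> 1 \<longrightarrow> D x \<le> slope x y) \<and>
     (\<forall>w. 0 < w \<longrightarrow> w < x \<longrightarrow> slope w x \<le> D x)" if x: "0 < x" "x < 1" for x
  proof -
    let ?A = "{x<..} \<inter> {..1}"
    have low: "slope w x \<le> slope x y" if "0 < w" "w < x" "y \<in> ?A" for w y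
      using slope_chain[of w x x y] that by simp
    have t: "(slope x \<longlongrightarrow> Inf (slope x ` ?A)) (at x within ?A)"
      by (rule Lim_right_bound[where K = "slope (x/2) x"])
        (use low[of "x/2"] slope_left[of x] x in \<open>force simp: le_less\<close>)+
    have "at x within ?A = at_right x"
      by (rule at_within_nhd[of _ "{..<1}"]) (use x in auto)
    with t have t: "(slope x \<longlongrightarrow> Inf (slope x ` ?A)) (at_right x)" by simp
    have D: "D x = Inf (slope x ` ?A)"
      unfolding right_deriv_def using tendsto_Lim[OF _ t] by (simp add: slope_def[abs_def] f_def)
    have bdd: "bdd_below (slope x ` ?A)"
      using low[of "x/2"] x by (intro bdd_belowI2[of _ "slope (x/2) x"]) auto
    have ne: "?A \<noteq> {}" using x by (auto intro!: exI[of _ 1])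
    show ?thesis unfolding D using t
      by (auto intro!: cINF_lower bdd cINF_greatest low ne)
  qed
  show "0 < x \<Longrightarrow> x < 1 \<Longrightarrow> (slope x \<longlongrightarrow> D x) (at_right x)"
    "0 < x \<Longrightarrow> x < y \<Longrightarrow> y \<le> 1 \<Longrightarrow> D x \<le> slope x y"
    "0 < w \<Longrightarrow> w < x \<Longrightarrow> x < 1 \<Longrightarrow> slope w x \<le> D x"
    using *[of x] by auto
qed

lemma D_mono: "0 < x \<Longrightarrow> x \<le> y \<Longrightarrow> y < 1 \<Longrightarrow> D x \<le> D y"
  using D_le_slope[of x y] slope_le_D[of x y] by (cases "x = y") auto

lemma D_neg: "0 < x \<Longrightarrow> x < 1 \<Longrightarrow> D x < 0"
  using D_le_slope[of x 1] slope_neg[of x 1] by simp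

lemma f_has_right_derivative: "0 < x \<Longrightarrow> x < 1 \<Longrightarrow> (f has_real_derivative D x) (at_right x)"
  using slope_tendsto[of x] by (simp add: has_field_derivative_iff slope_def[abs_def])

lemma isCont_f: "0 < x \<Longrightarrow> x < 1 \<Longrightarrow> isCont f x"
  using continuous_on_interior[OF f_continuous, of x] by simp

lemma f_tendsto_right: "0 < x \<Longrightarrow> x < 1 \<Longrightarrow> (f \<longlongrightarrow> f x) (at_right x)"
  using tendsto_within_subset[OF isContD[OF isCont_f] subset_UNIV] .

text \<open>
  For \<open>z\<close> slightly right of \<open>x\<close> and a fixed \<open>y\<close>, \<open>D z\<close> is at most the slope from \<open>z\<close> to \<open>y\<close>, which is near the slope from
  \<open>x\<close> to \<open>y\<close>, and the latter is near \<open>D x\<close> when \<open>y\<close> is close to \<open>x\<close>.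
\<close>

lemma D_tendsto_right:
  assumes x: "0 < x" "x < 1"
  shows "(D \<longlongrightarrow> D x) (at_right x)"
proof (rule order_tendstoI)
  have ev: "eventually (\<lambda>z. x < z \<and> z < b) (at_right x)" if "x < b" for b
    using eventually_at_right_real[OF that] by simp
  show "eventually (\<lambda>z. a < D z) (at_right x)" if "a < D x" for a
    using ev[OF x(2)]
  proof eventually_elim
    case (elim z)
    then show ?case using D_mono[of x z] x that by simp
  qed
  show "eventually (\<lambda>z. D z < a) (at_right x)" if "D x < a" for a
  proof -
    have "eventually (\<lambda>y. slope x y < a \<and> x < y \<and> y < 1) (at_right x)"
      using order_tendstoD(2)[OF slope_tendsto[OF x] that] ev[OF x(2)] by (rule eventually_conj)
    then obtain y where y: "slope x y < a" "x < y" "y < 1"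
      using eventually_happens trivial_limit_at_right_real by blast
    have "((\<lambda>z. slope z y) \<longlongrightarrow> slope x y) (at_right x)"
      unfolding slope_def by (intro tendsto_intros f_tendsto_right) (use x y in auto)
    from order_tendstoD(2)[OF this y(1)] ev[OF y(2)] show ?thesis
    proof eventually_elim
      case (elim z)
      then show ?case using D_le_slope[of z y] x y by simp
    qed
  qed
qed

lemma D_discontinuities_countable: "countable ({0<..<1} - cont_points D)"
proof -
  have "mono_on {0<..<1} D" by (auto intro!: mono_onI D_mono)
  from mono_on_ctble_discont_open[OF _ this] have "countable {a \<in> {0<..<1}. \<not> isCont D a}" by simp
  moreover have "{a \<in> {0<..<1}. \<not> isCont D a} = {0<..<1} - cont_points D"
    by (auto simp: cont_points_def)
  ultimately show ?thesis by simp
qed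

lemma cont_point_between:
  assumes "0 \<le> a" "a < b" "b \<le> 1"
  obtains x where "a < x" "x < b" "x \<in> cont_points D"
proof -
  have "uncountable ({a<..<b} - ({0<..<1} - cont_points D))"
    using assms by (intro uncountable_minus_countable D_discontinuities_countable)
      (simp add: uncountable_open_interval)
  then have "{a<..<b} - ({0<..<1} - cont_points D) \<noteq> {}" by (metis countable_empty)
  then show thesis using that assms by force
qed

text \<open>
  The zero of the tangent line \<open>s \<mapsto> f x + D x * (s - x)\<close>, which turns out to be the value of the
  Kendall distribution function at \<open>x\<close>.
\<close>

definition tangent_zero :: "real \<Rightarrow> real" where "tangent_zero x = x - f x / D x"

lemma tangent_zero_greater: "0 < x \<Longrightarrow> x < 1 \<Longrightarrow> x < tangent_zero x"
  using f_pos[of x] D_neg[of x] by (simp add: tangent_zero_def divide_pos_neg)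

text \<open>
  The tangent at \<open>x\<close> lies below \<open>f\<close>, so a line with the same slope through \<open>(y, f y)\<close> has its zero at
  the same place or further right.
\<close>

lemma tangent_zero_mono_aux:
  assumes "0 < x" "x < y" "y \<le> 1"
  shows "tangent_zero x \<le> y - f y / D x"
proof -
  have "D x * (y - x) \<le> f y - f x"
    using D_le_slope[of x y] assms by (simp add: slope_def pos_le_divide_eq)
  then have "(f y - f x) / D x \<le> y - x"
    using D_neg[of x] assms by (simp add: neg_divide_le_eq mult.commute)
  then show ?thesis by (simp add: tangent_zero_def diff_divide_distrib)
qed

lemma tangent_zero_le_1: "0 < x \<Longrightarrow> x < 1 \<Longrightarrow> tangent_zero x \<le> 1"
  using tangent_zero_mono_aux[of x 1] f_1 by simp

lemma tangent_zero_mono: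
  assumes "0 < x" "x \<le> y" "y < 1"
  shows "tangent_zero x \<le> tangent_zero y"
proof (cases "x = y")
  case False
  have "f y / D y \<le> f y / D x"
    using D_mono[of x y] D_neg[of x] D_neg[of y] assms by (intro divide_left_mono) (auto simp: mult_neg_neg)
  then show ?thesis using tangent_zero_mono_aux[of x y] assms False by (simp add: tangent_zero_def)
qed simp

lemma tangent_zero_tendsto_right: "0 < x \<Longrightarrow> x < 1 \<Longrightarrow> (tangent_zero \<longlongrightarrow> tangent_zero x) (at_right x)"
  unfolding tangent_zero_def
  by (intro tendsto_intros D_tendsto_right f_tendsto_right) (use D_neg[of x] in auto)

section \<open>Integrals of the reciprocal generator\<close>

text \<open>
  The right derivative of \<open>1 / f\<close>, extended by 0 outside \<open>(0, 1)\<close>.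
\<close>

definition h :: "real \<Rightarrow> real" where
  "h s = indicator {0<..<1} s * (- D s / (f s)\<^sup>2)"

lemma f_has_integral:
  assumes "0 < a" "a < b" "b \<le> 1"
  shows "(D has_integral f b - f a) {a..b}"
proof -
  obtain L where L: "0 \<le> L" "\<And>x y. a \<le> x \<Longrightarrow> x \<le> 1 \<Longrightarrow> a \<le> y \<Longrightarrow> y \<le> 1 \<Longrightarrow> \<bar>f y - f x\<bar> \<le> L * \<bar>y - x\<bar>"
    using f_lipschitz[of a] assms by auto
  show ?thesis
    by (rule FTC_right_derivative[where L = L])
      (use assms in \<open>auto intro!: L(2) f_has_right_derivative\<close>)
qed

lemma ln_f_has_integral:
  assumes "0 < a" "a < b" "b < 1"
  shows "((\<lambda>x. D x / f x) has_integral ln (f b) - ln (f a)) {a..b}"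
proof -
  obtain L where L: "0 \<le> L" "\<And>x y. a \<le> x \<Longrightarrow> x \<le> 1 \<Longrightarrow> a \<le> y \<Longrightarrow> y \<le> 1 \<Longrightarrow> \<bar>f y - f x\<bar> \<le> L * \<bar>y - x\<bar>"
    using f_lipschitz[of a] assms by auto
  have fb: "0 < f b" using f_pos assms by simp
  show ?thesis
  proof (rule FTC_right_derivative[where L = "L / f b"])
    fix x y assume xy: "x \<in> {a..b}" "y \<in> {a..b}"
    have *: "ln (f v) - ln (f u) \<le> L * \<bar>v - u\<bar> / f b" if "u \<in> {a..b}" "v \<in> {a..b}" for u v
    proof -
      have pos: "f b \<le> f u" "0 < f u" "0 < f v"
        using f_antimono[of u b] f_pos[of u] f_pos[of v] that assms by auto
      have "ln (f v) - ln (f u) \<le> (f v - f u) / f u"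
        using ln_diff_le[of "f v" "f u"] pos by simp
      also have "\<dots> \<le> L * \<bar>v - u\<bar> / f u"
        using L(2)[of u v] that assms pos by (intro divide_right_mono) auto
      also have "\<dots> \<le> L * \<bar>v - u\<bar> / f b"
        using pos fb L(1) by (intro divide_left_mono) auto
      finally show ?thesis .
    qed
    show "\<bar>ln (f y) - ln (f x)\<bar> \<le> L / f b * \<bar>y - x\<bar>"
      using *[OF xy] *[OF xy(2,1)] by (simp add: abs_le_iff abs_minus_commute)
  next
    fix x assume "x \<in> {a<..<b}"
    then have x: "0 < x" "x < 1" using assms by auto
    show "((\<lambda>x. ln (f x)) has_real_derivative D x / f x) (at_right x)"
      using f_pos[OF x] f_has_right_derivative[OF x]
      by (auto intro!: derivative_eq_intros)
  qed (use assms in simp)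
qed

lemma inverse_f_lipschitz:
  assumes "0 < a" "b < 1"
  obtains L where "0 \<le> L" "\<And>x y. x \<in> {a..b} \<Longrightarrow> y \<in> {a..b} \<Longrightarrow> \<bar>1 / f y - 1 / f x\<bar> \<le> L * \<bar>y - x\<bar>"
proof (cases "a \<le> b")
  case True
  then obtain L where L: "0 \<le> L" "\<And>x y. a \<le> x \<Longrightarrow> x \<le> 1 \<Longrightarrow> a \<le> y \<Longrightarrow> y \<le> 1 \<Longrightarrow> \<bar>f y - f x\<bar> \<le> L * \<bar>y - x\<bar>"
    using f_lipschitz[of a] assms by auto
  have fb: "0 < f b" using f_pos assms True by simp
  show ?thesis
  proof
    show "0 \<le> L / (f b * f b)" using L fb by simp
    fix x y assume xy: "x \<in> {a..b}" "y \<in> {a..b}"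
    have pos: "f b \<le> f x" "f b \<le> f y"
      using f_antimono[of x b] f_antimono[of y b] xy assms by auto
    have "1 / f y - 1 / f x = (f x - f y) / (f x * f y)" using pos fb by (simp add: field_simps)
    then have "\<bar>1 / f y - 1 / f x\<bar> = \<bar>f y - f x\<bar> / (f x * f y)"
      by (simp add: abs_divide abs_mult abs_minus_commute)
    also have "\<dots> \<le> (L * \<bar>y - x\<bar>) / (f x * f y)"
      using L(2)[of x y] xy assms by (intro divide_right_mono) auto
    also have "\<dots> \<le> (L * \<bar>y - x\<bar>) / (f b * f b)"
      using pos fb L(1) by (intro divide_left_mono mult_mono) auto
    finally show "\<bar>1 / f y - 1 / f x\<bar> \<le> L / (f b * f b) * \<bar>y - x\<bar>" by simp
  qed
next
  case False
  then show ?thesis using that[of 0] by auto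
qed

lemma inverse_f_has_right_derivative:
  "0 < x \<Longrightarrow> x < 1 \<Longrightarrow> ((\<lambda>x. 1 / f x) has_real_derivative h x) (at_right x)"
  using f_pos[of x] f_has_right_derivative[of x]
  by (auto intro!: derivative_eq_intros simp: h_def power2_eq_square)

lemma inverse_f_has_integral:
  assumes "0 < a" "a < b" "b < 1"
  shows "(h has_integral 1 / f b - 1 / f a) {a..b}"
proof -
  obtain L where L: "0 \<le> L" "\<And>x y. x \<in> {a..b} \<Longrightarrow> y \<in> {a..b} \<Longrightarrow> \<bar>1 / f y - 1 / f x\<bar> \<le> L * \<bar>y - x\<bar>"
    using inverse_f_lipschitz[of a b] assms by auto
  show ?thesis
    by (rule FTC_right_derivative[where L = L])
      (use assms in \<open>auto intro!: L(2) inverse_f_has_right_derivative\<close>)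
qed

text \<open>
  The integrand is the derivative of \<open>s / f s\<close>: in \<open>h s * (s - f s / D s)\<close> the second term contributes \<open>1 / f s\<close>.
\<close>

lemma id_over_f_has_integral:
  assumes "0 < a" "a < b" "b < 1"
  shows "((\<lambda>s. h s * tangent_zero s) has_integral b / f b - a / f a) {a..b}"
proof -
  obtain L where L: "0 \<le> L" "\<And>x y. x \<in> {a..b} \<Longrightarrow> y \<in> {a..b} \<Longrightarrow> \<bar>1 / f y - 1 / f x\<bar> \<le> L * \<bar>y - x\<bar>"
    using inverse_f_lipschitz[of a b] assms by auto
  have fb: "0 < f b" using f_pos assms by simp
  show ?thesis
  proof (rule FTC_right_derivative[where L = "L + 1 / f b"])
    fix x y assume xy: "x \<in> {a..b}" "y \<in> {a..b}"
    have pos: "f b \<le> f x" using f_antimono[of x b] xy assms by auto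
    have "y / f y - x / f x = y * (1 / f y - 1 / f x) + (y - x) / f x"
      by (simp add: right_diff_distrib diff_divide_distrib)
    then have "\<bar>y / f y - x / f x\<bar> \<le> y * \<bar>1 / f y - 1 / f x\<bar> + \<bar>y - x\<bar> / f x"
      using abs_triangle_ineq[of "y * (1 / f y - 1 / f x)" "(y - x) / f x"] xy assms
      by (simp add: abs_mult abs_divide)
    also have "\<dots> \<le> 1 * (L * \<bar>y - x\<bar>) + \<bar>y - x\<bar> / f b"
      using pos fb xy assms L by (intro add_mono mult_mono divide_left_mono) auto
    finally show "\<bar>y / f y - x / f x\<bar> \<le> (L + 1 / f b) * \<bar>y - x\<bar>"
      by (simp add: distrib_right)
  next
    fix x assume "x \<in> {a<..<b}"
    then have x: "0 < x" "x < 1" using assms by auto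
    have "h x * tangent_zero x = x * h x + 1 / f x"
      using x f_pos[OF x] D_neg[OF x] by (simp add: h_def tangent_zero_def field_simps power2_eq_square)
    moreover have "((\<lambda>x. x * (1 / f x)) has_real_derivative x * h x + 1 * (1 / f x)) (at_right x)"
      by (intro DERIV_mult' inverse_f_has_right_derivative x DERIV_ident)
    ultimately show "((\<lambda>x. x / f x) has_real_derivative h x * tangent_zero x) (at_right x)" by simp
  qed (use assms in simp)
qed

text \<open>
  Inversion is continuous on the extended half-line, which treats finite and infinite \<open>\<phi> 0\<close> alike.
\<close>

lemma inverse_f_tendsto_0: "((\<lambda>x. 1 / f x) \<longlongrightarrow> 1 / f 0) (at_right 0)"
proof -
  have pos: "\<phi> 0 > 0" using phi_strict[of 0 1] phi_1 by simp
  have e: "enn2real (inverse z) = 1 / enn2real z" for z :: ennreal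
    by (cases z rule: ennreal_cases; cases "enn2real z = 0")
      (auto simp: inverse_ennreal inverse_eq_divide order_less_le)
  have "((\<lambda>x. inverse (\<phi> x)) \<longlongrightarrow> inverse (\<phi> 0)) (at_right 0)"
    using continuous_on_tendsto_compose[OF continuous_on_inverse_ennreal[OF continuous_on_id] phi_tendsto_0, of UNIV]
    by simp
  moreover have "inverse (\<phi> 0) = ennreal (enn2real (inverse (\<phi> 0)))"
    using pos by (simp add: ennreal_enn2real_if)
  ultimately have "((\<lambda>x. enn2real (inverse (\<phi> x))) \<longlongrightarrow> enn2real (inverse (\<phi> 0))) (at_right 0)"
    by (intro tendsto_enn2real) auto
  then show ?thesis by (simp add: e f_def)
qed

lemma inverse_f_tendsto_right:
  assumes "0 \<le> t" "t < 1"
  shows "((\<lambda>x. 1 / f x) \<longlongrightarrow> 1 / f t) (at_right t)"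
proof (cases "t = 0")
  case False
  then show ?thesis using assms f_tendsto_right[of t] f_pos[of t] by (intro tendsto_intros) auto
qed (use inverse_f_tendsto_0 in simp)

lemma f_measurable: "(\<lambda>s. indicator {0<..<1} s * f s) \<in> borel_measurable borel"
  and D_measurable: "(\<lambda>s. indicator {0<..<1} s * D s) \<in> borel_measurable borel"
proof -
  have "mono_on {0<..<1} D" "mono_on {0<..<1} (\<lambda>s. - f s)"
    by (auto intro!: mono_onI D_mono f_antimono)
  from this[THEN borel_measurable_mono_on_fnc]
  have "D \<in> borel_measurable (restrict_space borel {0<..<1})"
    "f \<in> borel_measurable (restrict_space borel {0<..<1})"
    by simp_all
  then show "(\<lambda>s. indicator {0<..<1} s * f s) \<in> borel_measurable borel"
    "(\<lambda>s. indicator {0<..<1} s * D s) \<in> borel_measurable borel"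
    by (simp_all add: borel_measurable_restrict_space_iff)
qed

lemma h_measurable [measurable]: "h \<in> borel_measurable borel"
  and h_tangent_zero_measurable: "(\<lambda>s. h s * tangent_zero s) \<in> borel_measurable borel"
proof -
  define fi Di where "fi s = indicator {0<..<1} s * f s" and "Di s = indicator {0<..<1} s * D s" for s
  have [measurable]: "fi \<in> borel_measurable borel" "Di \<in> borel_measurable borel"
    using f_measurable D_measurable by (simp_all add: fi_def[abs_def] Di_def[abs_def])
  have h_eq: "h = (\<lambda>s. - Di s / (fi s)\<^sup>2)"
    by (rule ext) (simp add: h_def indicator_def fi_def Di_def)
  have hG_eq: "(\<lambda>s. h s * tangent_zero s) = (\<lambda>s. (- Di s / (fi s)\<^sup>2) * (s - fi s / Di s))"
    by (rule ext) (simp add: h_def tangent_zero_def indicator_def fi_def Di_def)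
  show "h \<in> borel_measurable borel" unfolding h_eq by measurable
  show "(\<lambda>s. h s * tangent_zero s) \<in> borel_measurable borel" unfolding hG_eq by measurable
qed

lemma h_nonneg: "0 \<le> h s"
proof (cases "s \<in> {0<..<1}")
  case True
  then have "0 \<le> - D s / (f s)\<^sup>2" using D_neg[of s] by (intro divide_nonneg_nonneg) auto
  then show ?thesis using True by (simp add: h_def)
qed (simp add: h_def)

lemma nn_integral_h:
  assumes "0 \<le> t" "t < c" "c < 1"
  shows "(\<integral>\<^sup>+s. ennreal (h s) * indicator {t<..c} s \<partial>lborel) = ennreal (1 / f c - 1 / f t)"
  using assms
  by (intro nn_integral_increment_half_open[where H = "\<lambda>x. 1 / f x"] inverse_f_tendsto_right
    inverse_f_has_integral h_measurable h_nonneg) auto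

lemma nn_integral_h_tangent_zero:
  assumes "0 < c" "c < 1"
  shows "(\<integral>\<^sup>+s. ennreal (h s * tangent_zero s) * indicator {0<..c} s \<partial>lborel) = ennreal (c / f c)"
proof -
  have "((\<lambda>x. x * (1 / f x)) \<longlongrightarrow> 0 * (1 / f 0)) (at_right 0)"
    by (intro tendsto_mult inverse_f_tendsto_0 tendsto_ident_at)
  then have l: "((\<lambda>x. x / f x) \<longlongrightarrow> 0) (at_right 0)" by simp
  have "(\<integral>\<^sup>+s. ennreal (h s * tangent_zero s) * indicator {0<..c} s \<partial>lborel) = ennreal (c / f c - 0)"
  proof (rule nn_integral_increment_half_open[where H = "\<lambda>x. x / f x", OF _ h_tangent_zero_measurable _ _ l])
    show "0 \<le> h s * tangent_zero s" if "0 < s" "s \<le> c" for s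
      using h_nonneg[of s] tangent_zero_greater[of s] that assms by simp
    show "((\<lambda>s. h s * tangent_zero s) has_integral c / f c - t / f t) {t..c}" if "0 < t" "t < c" for t
      using id_over_f_has_integral[of t c] that assms by simp
  qed (use assms in simp)
  then show ?thesis by simp
qed

section \<open>The Kendall distribution as a probability law\<close>

text \<open>
  The distribution function of \<open>T\<close>. Taking the infimum over points to the right makes it right-continuous, also at 0, where
  \<open>tangent_zero\<close> is not available; inside \<open>(0, 1)\<close> it agrees with \<open>tangent_zero\<close>. A jump at 0 is possible.
\<close>

definition kendall_cdf :: "real \<Rightarrow> real" where
  "kendall_cdf x = (if x < 0 then 0 else if x < 1 then (INF y\<in>{x<..<1}. tangent_zero y) else 1)"

lemma tangent_zero_bounds: "0 < y \<Longrightarrow> y < 1 \<Longrightarrow> 0 \<le> tangent_zero y \<and> tangent_zero y \<le> 1"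
  using tangent_zero_greater[of y] tangent_zero_le_1[of y] by simp

lemma tangent_zero_bdd_below: "0 \<le> x \<Longrightarrow> bdd_below (tangent_zero ` {x<..<1})"
  by (rule bdd_belowI2[of _ 0]) (use tangent_zero_bounds in auto)

lemma kendall_cdf_le_tangent_zero: "0 \<le> x \<Longrightarrow> x < y \<Longrightarrow> y < 1 \<Longrightarrow> kendall_cdf x \<le> tangent_zero y"
  by (auto simp: kendall_cdf_def intro!: cINF_lower tangent_zero_bdd_below)

lemma kendall_cdf_bounds: "0 \<le> kendall_cdf x \<and> kendall_cdf x \<le> 1"
proof (cases "0 \<le> x \<and> x < 1")
  case True
  then have "kendall_cdf x \<le> tangent_zero ((x + 1) / 2)" by (intro kendall_cdf_le_tangent_zero) auto
  also have "\<dots> \<le> 1" using True tangent_zero_bounds[of "(x + 1) / 2"] by auto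
  finally have "kendall_cdf x \<le> 1" .
  moreover have "0 \<le> kendall_cdf x"
    using True tangent_zero_bounds by (auto simp: kendall_cdf_def intro!: cINF_greatest)
  ultimately show ?thesis by simp
qed (auto simp: kendall_cdf_def)

lemma kendall_cdf_mono: "x \<le> y \<Longrightarrow> kendall_cdf x \<le> kendall_cdf y"
proof (cases "0 \<le> x \<and> y < 1")
  case True
  assume "x \<le> y"
  with True show ?thesis
    by (auto simp: kendall_cdf_def intro!: cINF_superset_mono tangent_zero_bdd_below)
next
  case False
  assume "x \<le> y"
  with False show ?thesis using kendall_cdf_bounds[of x] kendall_cdf_bounds[of y] by (auto simp: kendall_cdf_def)
qed

lemma kendall_cdf_eq_tangent_zero:
  assumes x: "0 < x" "x < 1"
  shows "kendall_cdf x = tangent_zero x"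
proof (rule antisym)
  show "tangent_zero x \<le> kendall_cdf x" using x tangent_zero_mono[of x] by (auto simp: kendall_cdf_def intro!: cINF_greatest)
  have "eventually (\<lambda>y. kendall_cdf x \<le> tangent_zero y) (at_right x)"
    using eventually_at_right_real[OF x(2)] by eventually_elim (use x in \<open>auto intro!: kendall_cdf_le_tangent_zero\<close>)
  then show "kendall_cdf x \<le> tangent_zero x"
    using tendsto_lowerbound[OF tangent_zero_tendsto_right[OF x]] by simp
qed

lemma kendall_cdf_right_continuous: "continuous (at_right x) kendall_cdf"
  unfolding continuous_within
proof (rule order_tendstoI)
  have "eventually (\<lambda>y. x < y) (at_right x)" by (simp add: eventually_at_filter)
  then show "eventually (\<lambda>y. a < kendall_cdf y) (at_right x)" if "a < kendall_cdf x" for a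
    by eventually_elim (use that kendall_cdf_mono[of x] in \<open>auto intro: less_le_trans\<close>)
  show "eventually (\<lambda>y. kendall_cdf y < a) (at_right x)" if a: "kendall_cdf x < a" for a
  proof -
    consider "x < 0" | "0 \<le> x" "x < 1" | "1 \<le> x" by linarith
    then show ?thesis
    proof cases
      case 1
      from eventually_at_right_real[OF 1] show ?thesis
        by eventually_elim (use a 1 in \<open>auto simp: kendall_cdf_def\<close>)
    next
      case 2
      then obtain y where y: "y \<in> {x<..<1}" "tangent_zero y < a"
        using a by (auto simp: kendall_cdf_def cINF_less_iff tangent_zero_bdd_below)
      from eventually_at_right_real[of x y] y(1) show ?thesis
        by (auto elim!: eventually_mono intro!: le_less_trans[OF kendall_cdf_le_tangent_zero y(2)] simp: 2 intro: order_trans[OF 2(1)])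
    next
      case 3
      from \<open>eventually (\<lambda>y. x < y) (at_right x)\<close> show ?thesis
        by eventually_elim (use a 3 in \<open>auto simp: kendall_cdf_def\<close>)
    qed
  qed
qed

lemma kendall_cdf_at_bot: "(kendall_cdf \<longlongrightarrow> 0) at_bot"
  by (rule tendsto_eventually, rule eventually_mono[OF eventually_gt_at_bot[of 0]]) (simp add: kendall_cdf_def)

lemma kendall_cdf_at_top: "(kendall_cdf \<longlongrightarrow> 1) at_top"
  by (rule tendsto_eventually, rule eventually_mono[OF eventually_ge_at_top[of 1]]) (simp add: kendall_cdf_def)

definition \<mu> :: "real measure" where "\<mu> = interval_measure kendall_cdf"

sublocale \<mu>: real_distribution \<mu>
  unfolding \<mu>_def by (rule real_distribution_interval_measure[OF kendall_cdf_mono kendall_cdf_right_continuous kendall_cdf_at_bot kendall_cdf_at_top])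

lemma measure_\<mu>_atMost: "measure \<mu> {..x} = kendall_cdf x"
  unfolding \<mu>_def by (rule measure_interval_measure_Iic[OF kendall_cdf_mono kendall_cdf_right_continuous kendall_cdf_at_bot])

lemma emeasure_\<mu>_atMost: "emeasure \<mu> {..x} = ennreal (kendall_cdf x)"
  by (simp add: \<mu>.emeasure_eq_measure measure_\<mu>_atMost)

text \<open>
  There is no atom at 1 because \<open>x < tangent_zero x \<le> 1\<close> forces the limit 1 from the left. This matters since
  \<open>1 / f\<close> has a pole at 1.
\<close>

lemma \<mu>_AE_less_1: "AE t in \<mu>. t < 1"
proof -
  have "measure \<mu> {1..} \<le> e" if e: "0 < e" for e
  proof -
    \<comment> \<open>Any point of (0, 1) at distance at most e from 1 would do.\<close>
    define x where "x = max (1/2) (1 - e)"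
    have x: "0 < x" "x < 1" using e by (auto simp: x_def)
    have "measure \<mu> {1..} \<le> measure \<mu> (UNIV - {..x})"
      using x by (intro \<mu>.finite_measure_mono) auto
    also have "\<dots> = 1 - kendall_cdf x"
      using \<mu>.prob_compl[of "{..x}"] by (simp add: measure_\<mu>_atMost)
    also have "\<dots> \<le> 1 - x" using kendall_cdf_eq_tangent_zero[OF x] tangent_zero_greater[OF x] by simp
    also have "\<dots> \<le> e" by (simp add: x_def)
    finally show ?thesis .
  qed
  then have "measure \<mu> {1..} = 0"
    by (metis dense_ge_bounded dense_le linorder_not_less measure_nonneg order_le_less)
  then have "emeasure \<mu> {1..} = 0" by (simp add: \<mu>.emeasure_eq_measure)
  then show ?thesis
    by (intro AE_I[of _ _ "{1..}"]) auto
qed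

text \<open>
  Outside \<open>[0, 1]\<close> the values of a generator are arbitrary and need not depend measurably on the argument, and \<open>T\<close> lies in \<open>[0, 1]\<close> only
  almost surely.
\<close>

definition to_unit :: "real \<Rightarrow> real" where "to_unit t = max 0 (min 1 t)"

lemma to_unit_range: "to_unit t \<in> {0..1}" by (simp add: to_unit_def)

text \<open>
  The core computation: the layer-cake formula for \<open>1 - f c / f T\<close> and an exchange of integrals reduce the expectation to the
  integral of the derivative of \<open>s / f s\<close> over \<open>(0, c]\<close>. Negative values of \<open>1 - f c / f T\<close>, which occur for
  \<open>c < T < 1\<close>, are cut off by \<open>ennreal\<close>.
\<close>

lemma expectation_truncated:
  assumes c: "0 < c" "c < 1"
  shows "(\<integral>\<^sup>+t. ennreal (1 - f c * (1 / f (to_unit t))) \<partial>\<mu>) = ennreal c"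
proof -
  have fc: "0 < f c" using f_pos c by simp
  \<comment> \<open>Closed at t, so that integrating over T produces the distribution function at s; the single point is
    negligible for the integral over s.\<close>
  let ?K = "\<lambda>t s. ennreal (h s) * indicator {0<..c} s * indicator {t..} s"
  have inner: "ennreal (1 - f c * (1 / f (to_unit t))) = ennreal (f c) * (\<integral>\<^sup>+s. ?K t s \<partial>lborel)" if t: "t < 1" for t
  proof (cases "t < c")
    case True
    let ?u = "to_unit t"
    have u: "0 \<le> ?u" "?u < c" using True c by (auto simp: to_unit_def)
    have "(\<integral>\<^sup>+s. ?K t s \<partial>lborel) = (\<integral>\<^sup>+s. ennreal (h s) * indicator {?u<..c} s \<partial>lborel)"
    proof (rule nn_integral_cong_AE)
      show "AE s in lborel. ?K t s = ennreal (h s) * indicator {?u<..c} s"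
        using AE_lborel_singleton[of t]
        by eventually_elim (use c True in \<open>auto simp: indicator_def to_unit_def\<close>)
    qed
    also have "\<dots> = ennreal (1 / f c - 1 / f ?u)"
      using u c by (intro nn_integral_h) auto
    finally show ?thesis
      using fc by (simp add: ennreal_mult'[symmetric] right_diff_distrib)
  next
    case False
    have "(\<integral>\<^sup>+s. ?K t s \<partial>lborel) = (\<integral>\<^sup>+s. 0 \<partial>(lborel :: real measure))"
      using AE_lborel_singleton[of t]
      by (intro nn_integral_cong_AE, eventually_elim) (use False in \<open>auto simp: indicator_def\<close>)
    moreover have "to_unit t = t" "f t \<le> f c" "0 < f t"
      using False c t f_antimono[of c t] f_pos[of t] by (auto simp: to_unit_def)
    moreover from this have "1 - f c * (1 / f (to_unit t)) \<le> 0" by (simp add: field_simps)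
    ultimately show ?thesis by (simp add: ennreal_neg)
  qed
  interpret pair_sigma_finite \<mu> "lborel :: real measure" ..
  have m: "(\<lambda>(t, s). ?K t s) \<in> borel_measurable (\<mu> \<Otimes>\<^sub>M lborel)"
  proof -
    have e: "(\<lambda>(t, s). ?K t s) = (\<lambda>(t, s). ennreal (h s) * indicator {0<..c} s * (if t \<le> s then 1 else 0))"
      by (auto simp: fun_eq_iff indicator_def)
    show ?thesis unfolding e split_beta by measurable
  qed
  have "(\<integral>\<^sup>+t. ennreal (1 - f c * (1 / f (to_unit t))) \<partial>\<mu>) = (\<integral>\<^sup>+t. ennreal (f c) * (\<integral>\<^sup>+s. ?K t s \<partial>lborel) \<partial>\<mu>)"
    using \<mu>_AE_less_1 by (intro nn_integral_cong_AE, eventually_elim) (rule inner)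
  also have "\<dots> = ennreal (f c) * (\<integral>\<^sup>+t. (\<integral>\<^sup>+s. ?K t s \<partial>lborel) \<partial>\<mu>)"
    using lborel.borel_measurable_nn_integral_fst[OF m] by (intro nn_integral_cmult) simp
  also have "(\<integral>\<^sup>+t. (\<integral>\<^sup>+s. ?K t s \<partial>lborel) \<partial>\<mu>) = (\<integral>\<^sup>+s. (\<integral>\<^sup>+t. ?K t s \<partial>\<mu>) \<partial>lborel)"
    using Fubini'[OF m] by simp
  also have "\<dots> = (\<integral>\<^sup>+s. ennreal (h s * tangent_zero s) * indicator {0<..c} s \<partial>lborel)"
  proof (rule nn_integral_cong)
    fix s :: real
    \<comment> \<open>Read as a function of t, the last factor of the kernel is the indicator of the event that T is at most s.\<close>
    have i: "indicator {t..} s = (indicator {..s} t :: ennreal)" for t by (simp add: indicator_def)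
    have "(\<integral>\<^sup>+t. ?K t s \<partial>\<mu>) = ennreal (h s) * indicator {0<..c} s * ennreal (kendall_cdf s)"
      by (simp add: i nn_integral_cmult emeasure_\<mu>_atMost)
    also have "\<dots> = ennreal (h s * tangent_zero s) * indicator {0<..c} s"
      using h_nonneg[of s] kendall_cdf_eq_tangent_zero[of s] tangent_zero_bounds[of s] c by (auto simp: indicator_def ennreal_mult)
    finally show "(\<integral>\<^sup>+t. ?K t s \<partial>\<mu>) = ennreal (h s * tangent_zero s) * indicator {0<..c} s" .
  qed
  also have "\<dots> = ennreal (c / f c)" by (rule nn_integral_h_tangent_zero[OF c])
  also have "ennreal (f c) * ennreal (c / f c) = ennreal c"
    using fc c by (simp add: ennreal_mult'[symmetric])
  finally show ?thesis .
qed

section \<open>A random vector distributed according to the copula\<close>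

text \<open>
  The value \<open>\<phi> T\<close>. It is the radial part of the vector \<open>(\<phi> X, \<phi> Y) = \<phi> T * (S, 1 - S)\<close>, whose direction is
  uniform on the simplex.
\<close>

definition R :: "real \<Rightarrow> ennreal" where "R t = \<phi> (to_unit t)"

definition \<nu> :: "real measure" where "\<nu> = uniform_measure lborel {0<..<1}"

sublocale \<nu>: prob_space \<nu>
  unfolding \<nu>_def by (rule prob_space_uniform_measure) auto

lemma sets_\<nu> [simp, measurable_cong]: "sets \<nu> = sets borel" by (simp add: \<nu>_def)

lemma space_\<nu> [simp]: "space \<nu> = UNIV" by (simp add: \<nu>_def)

definition P :: "(real \<times> real) measure" where "P = \<mu> \<Otimes>\<^sub>M \<nu>"

sublocale P: pair_prob_space \<mu> \<nu> ..

lemma sets_P [measurable_cong]: "sets P = sets (borel \<Otimes>\<^sub>M borel)"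
  unfolding P_def by (intro sets_pair_measure_cong) auto

lemma space_P: "space P = UNIV"
  by (simp add: P_def space_pair_measure)

lemma prob_space_P: "prob_space P"
  unfolding P_def by (rule P.prob_space_axioms)

definition X :: "real \<times> real \<Rightarrow> real" where "X = (\<lambda>(t, s). \<psi> (R t * ennreal s))"

definition Y :: "real \<times> real \<Rightarrow> real" where "Y = (\<lambda>(t, s). \<psi> (R t * ennreal (1 - s)))"

lemma R_measurable [measurable]: "R \<in> borel_measurable borel"
proof -
  have "continuous_on UNIV to_unit" unfolding to_unit_def by (intro continuous_intros)
  then have "continuous_on UNIV (\<lambda>t. \<phi> (to_unit t))"
    by (rule continuous_on_compose2[OF phi_continuous]) (use to_unit_range in blast)
  then show ?thesis unfolding R_def by (rule borel_measurable_continuous_onI)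
qed

lemma psi_measurable [measurable]: "\<psi> \<in> borel_measurable borel"
proof (rule borel_measurableI_le)
  fix a :: real
  consider "a < 0" | "a \<in> {0..1}" | "1 < a" by fastforce
  then have "{z. \<psi> z \<le> a} \<in> {{}, {\<phi> a..}, UNIV}"
  proof cases
    case 1
    then have "\<not> \<psi> z \<le> a" for z using psi_range[of z] by simp
    then show ?thesis by simp
  next
    case 2
    then show ?thesis by (simp add: psi_le_iff atLeast_def)
  next
    case 3
    then have "\<psi> z \<le> a" for z using psi_range[of z] by simp
    then show ?thesis by simp
  qed
  then show "{z \<in> space borel. \<psi> z \<le> a} \<in> sets borel" by auto
qed

lemma X_measurable [measurable]: "X \<in> borel_measurable P"
  and Y_measurable [measurable]: "Y \<in> borel_measurable P"
  unfolding X_def Y_def by measurable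

lemma XY_range: "X w \<in> {0..1}" "Y w \<in> {0..1}"
  using psi_range by (simp_all add: X_def Y_def split_beta)

lemma X_le_iff: "x \<in> {0..1} \<Longrightarrow> X (t, s) \<le> x \<longleftrightarrow> \<phi> x \<le> R t * ennreal s"
  and Y_le_iff: "x \<in> {0..1} \<Longrightarrow> Y (t, s) \<le> x \<longleftrightarrow> \<phi> x \<le> R t * ennreal (1 - s)"
  by (simp_all add: X_def Y_def psi_le_iff)

text \<open>
  Since \<open>\<phi> T * S\<close> and \<open>\<phi> T * (1 - S)\<close> do not exceed \<open>\<phi> 0\<close>, the generator undoes the pseudoinverse, and the two values
  add up to \<open>\<phi> T\<close>.
\<close>

lemma copula_XY:
  assumes "s \<in> {0..1}"
  shows "archimedean_copula \<phi> (X (t, s)) (Y (t, s)) = to_unit t"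
proof -
  have le: "R t * ennreal u \<le> \<phi> 0" if "u \<in> {0..1}" for u
  proof -
    have "R t * ennreal u \<le> \<phi> 0 * 1"
      using that phi_le_iff[OF to_unit_range, of 0 t] to_unit_range[of t]
      by (intro mult_mono) (auto simp: R_def)
    then show ?thesis by simp
  qed
  have "\<phi> (X (t, s)) + \<phi> (Y (t, s)) = R t * ennreal s + R t * ennreal (1 - s)"
    using le[of s] le[of "1 - s"] assms by (simp add: X_def Y_def phi_psi min_absorb1)
  also have "\<dots> = R t * (ennreal s + ennreal (1 - s))" by (simp add: distrib_left)
  also have "ennreal s + ennreal (1 - s) = 1"
    using assms by (simp add: ennreal_plus[symmetric] del: ennreal_plus)
  finally show ?thesis
    using psi_phi[OF to_unit_range, of t] by (simp add: archimedean_copula_def R_def)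
qed

text \<open>
  The reciprocal \<open>1 / f\<close> also covers \<open>\<phi> T = \<infinity>\<close>: it is then 0, and the right-hand side holds for all \<open>s > 0\<close>, as does the left.
\<close>

lemma le_R_mult_iff:
  assumes t: "t < 1" and s: "0 < s" and x: "x \<in> {0<..1}"
  shows "\<phi> x \<le> R t * ennreal s \<longleftrightarrow> f x * (1 / f (to_unit t)) \<le> s"
proof -
  let ?u = "to_unit t"
  have u: "?u \<in> {0..1}" "?u < 1" using t by (auto simp: to_unit_def)
  have pos: "0 < \<phi> ?u" using phi_strict[of ?u 1] u phi_1 by simp
  have fx: "\<phi> x = ennreal (f x)" using x by (simp add: phi_eq_f)
  show ?thesis
  proof (cases "\<phi> ?u = top")
    case True
    then have "f ?u = 0" by (simp add: f_def)
    then show ?thesis using True s by (simp add: R_def ennreal_top_mult fx)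
  next
    case False
    then have e: "\<phi> ?u = ennreal (f ?u)" by (simp add: f_def less_top)
    with pos have fu: "0 < f ?u" by simp
    have "\<phi> x \<le> R t * ennreal s \<longleftrightarrow> ennreal (f x) \<le> ennreal (f ?u * s)"
      using s by (simp add: fx R_def e ennreal_mult)
    also have "\<dots> \<longleftrightarrow> f x \<le> f ?u * s" using s fu by (intro ennreal_le_iff) simp
    also have "\<dots> \<longleftrightarrow> f x * (1 / f ?u) \<le> s" using fu by (simp add: field_simps)
    finally show ?thesis .
  qed
qed

lemma conditional_probability:
  assumes t: "t < 1" and xy: "x \<in> {0<..1}" "y \<in> {0<..1}"
  shows "emeasure \<nu> {s. X (t, s) \<le> x \<and> Y (t, s) \<le> y} = ennreal (1 - (f x + f y) * (1 / f (to_unit t)))"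
proof -
  let ?k = "1 / f (to_unit t)"
  let ?A = "{s. X (t, s) \<le> x \<and> Y (t, s) \<le> y}"
  have X: "{s \<in> UNIV. X (t, s) \<le> x \<and> Y (t, s) \<le> y} \<in> sets borel"
    unfolding X_def Y_def by measurable
  have "emeasure \<nu> ?A = emeasure lborel ({0<..<1} \<inter> ?A)"
    using X by (simp add: \<nu>_def divide_ennreal_def)
  also have "\<dots> = emeasure lborel {f x * ?k .. 1 - f y * ?k}"
  proof (rule emeasure_eq_AE)
    have iff: "s \<in> ?A \<longleftrightarrow> s \<in> {f x * ?k .. 1 - f y * ?k}" if "0 < s" "s < 1" for s
      using that xy le_R_mult_iff[OF t, of s x] le_R_mult_iff[OF t, of "1 - s" y]
      by (auto simp: X_le_iff Y_le_iff)
    show "AE s in lborel. s \<in> {0<..<1} \<inter> ?A \<longleftrightarrow> s \<in> {f x * ?k .. 1 - f y * ?k}"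
      using AE_lborel_singleton[of 0] AE_lborel_singleton[of 1]
    proof eventually_elim
      case (elim s)
      show ?case
      proof (cases "0 < s \<and> s < 1")
        case True
        then show ?thesis using iff[of s] by simp
      next
        case False
        have k: "0 \<le> f x * ?k" "0 \<le> f y * ?k" by (simp_all)
        have "s < 0 \<or> 1 < s" using False elim by linarith
        then have "\<not> (f x * ?k \<le> s \<and> s \<le> 1 - f y * ?k)" using k by linarith
        then show ?thesis using False by auto
      qed
    qed
  qed (use X in auto)
  also have "\<dots> = ennreal (1 - (f x + f y) * ?k)"
    by (auto simp: emeasure_lborel_Icc_eq ennreal_neg algebra_simps add_divide_distrib)
  finally show ?thesis .
qed

lemma joint_distribution_pos:
  assumes xy: "x \<in> {0<..1}" "y \<in> {0<..1}"
  shows "measure P {w. X w \<le> x \<and> Y w \<le> y} = archimedean_copula \<phi> x y"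
proof -
  let ?z = "f x + f y" and ?c = "archimedean_copula \<phi> x y"
  have z: "\<phi> x + \<phi> y = ennreal ?z" using xy by (simp add: phi_eq_f)
  have c: "?c = \<psi> (ennreal ?z)" by (simp add: archimedean_copula_def z)
  have m: "{w. X w \<le> x \<and> Y w \<le> y} \<in> sets P"
  proof -
    have "{w \<in> space P. X w \<le> x \<and> Y w \<le> y} \<in> sets P" by measurable
    then show ?thesis by (simp add: space_P)
  qed
  have "emeasure P {w. X w \<le> x \<and> Y w \<le> y} = (\<integral>\<^sup>+t. emeasure \<nu> (Pair t -` {w. X w \<le> x \<and> Y w \<le> y}) \<partial>\<mu>)"
    using m unfolding P_def by (rule \<nu>.emeasure_pair_measure_alt)
  also have "\<dots> = (\<integral>\<^sup>+t. ennreal (1 - ?z * (1 / f (to_unit t))) \<partial>\<mu>)"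
    using \<mu>_AE_less_1
    by (intro nn_integral_cong_AE, eventually_elim)
      (use conditional_probability[OF _ xy] in \<open>simp add: vimage_def\<close>)
  also have "\<dots> = ennreal ?c"
  \<comment> \<open>The copula vanishes exactly if the sum of the generator values reaches \<open>\<phi> 0\<close>; then at most one value of S meets both constraints.\<close>
  proof (cases "ennreal ?z < \<phi> 0")
    case True
    then obtain d where d: "0 < d" "d \<le> 1" "\<phi> d = ennreal ?z" by (rule phi_surj_pos)
    then have "ennreal (f d) = ennreal ?z" using phi_eq_f[of d] by simp
    then have zd: "?z = f d" by (subst (asm) ennreal_inj) auto
    have cd: "?c = d" using d psi_phi[of d] by (simp add: c)
    show ?thesis
    proof (cases "d = 1")
      case True
      then have "?z = 0" using zd f_1 by simp
      then show ?thesis using True cd \<mu>.emeasure_space_1 by simp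
    next
      case False
      then show ?thesis using expectation_truncated[of d] d zd cd by simp
    qed
  next
    case False
    then have "\<phi> 0 < top" using le_less_trans[OF _ ennreal_less_top, of "\<phi> 0" ?z] by (simp only: not_less)
    then have fin: "\<phi> 0 = ennreal (f 0)" by (simp add: f_def)
    have "ennreal (f 0) \<le> ennreal ?z" using False unfolding fin not_less .
    then have f0: "f 0 \<le> ?z" by (subst (asm) ennreal_le_iff) auto
    have "(\<integral>\<^sup>+t. ennreal (1 - ?z * (1 / f (to_unit t))) \<partial>\<mu>) = (\<integral>\<^sup>+t. 0 \<partial>\<mu>)"
      using \<mu>_AE_less_1
    proof (intro nn_integral_cong_AE, eventually_elim)
      case (elim t)
      let ?u = "to_unit t"
      have u: "?u \<in> {0..1}" "?u < 1" using elim by (auto simp: to_unit_def)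
      have pos: "0 < \<phi> ?u" using phi_strict[of ?u 1] u phi_1 by simp
      have le: "\<phi> ?u \<le> \<phi> 0" using phi_le_iff[of ?u 0] u by simp
      then have "\<phi> ?u < top" using \<open>\<phi> 0 < top\<close> by (rule le_less_trans)
      then have e: "\<phi> ?u = ennreal (f ?u)" by (simp add: f_def)
      have "0 < f ?u" using pos unfolding e by simp
      moreover have "f ?u \<le> f 0" using le unfolding fin e by (subst (asm) ennreal_le_iff) auto
      ultimately have "f ?u \<le> f 0" "0 < f ?u" by simp_all
      with f0 have "1 - ?z * (1 / f ?u) \<le> 0" by (simp add: field_simps)
      then show ?case by (simp add: ennreal_neg)
    qed
    moreover have "?c = 0" using False psi_ge by (simp add: c not_less)
    ultimately show ?thesis by simp
  qed
  finally show ?thesis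
    using copula_range[of x y] by (simp add: measure_def)
qed

text \<open>
  On the lower edges of the square both sides vanish: the probability is at most that of a strip of width \<open>e\<close>, which is \<open>e\<close>.
\<close>

lemma joint_distribution:
  assumes xy: "x \<in> {0..1}" "y \<in> {0..1}"
  shows "measure P {w. X w \<le> x \<and> Y w \<le> y} = archimedean_copula \<phi> x y"
proof (cases "x = 0 \<or> y = 0")
  case False
  then show ?thesis using xy by (intro joint_distribution_pos) auto
next
  case True
  interpret prob_space P by (rule prob_space_P)
  have m: "{w. X w \<le> a \<and> Y w \<le> b} \<in> sets P" for a b
  proof -
    have "{w \<in> space P. X w \<le> a \<and> Y w \<le> b} \<in> sets P" by measurable
    then show ?thesis by (simp add: space_P)
  qed
  have "measure P {w. X w \<le> x \<and> Y w \<le> y} \<le> e" if e: "0 < e" "e \<le> 1" for e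
  proof -
    have one: "archimedean_copula \<phi> e 1 = e" "archimedean_copula \<phi> 1 e = e"
      using e psi_phi[of e] by (simp_all add: archimedean_copula_def phi_1)
    show ?thesis
    proof (cases "x = 0")
      case x: True
      have "measure P {w. X w \<le> x \<and> Y w \<le> y} \<le> measure P {w. X w \<le> e \<and> Y w \<le> 1}"
        using x xy e by (intro finite_measure_mono m) auto
      then show ?thesis using joint_distribution_pos[of e 1] e one by simp
    next
      case x: False
      have "measure P {w. X w \<le> x \<and> Y w \<le> y} \<le> measure P {w. X w \<le> 1 \<and> Y w \<le> e}"
        using x True xy e by (intro finite_measure_mono m) auto
      then show ?thesis using joint_distribution_pos[of 1 e] e one by simp
    qed
  qed
  then have "measure P {w. X w \<le> x \<and> Y w \<le> y} \<le> 0"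
    by (intro dense_ge_bounded[of 0 1]) auto
  then have "measure P {w. X w \<le> x \<and> Y w \<le> y} = 0"
    by (simp add: measure_le_0_iff)
  then show ?thesis using True copula_0 by auto
qed

lemma copula_measure_eq:
  "copula_measure (archimedean_copula \<phi>) =
     distr P (restrict_space borel ({0..1} \<times> {0..1})) (\<lambda>w. (X w, Y w))" (is "_ = ?M")
  and XY_measurable: "(\<lambda>w. (X w, Y w)) \<in> measurable P (restrict_space borel ({0..1} \<times> {0..1}))"
proof -
  let ?Q = "{0..1} \<times> {0..1} :: (real \<times> real) set"
  interpret prob_space P by (rule prob_space_P)
  have XY: "(\<lambda>w. (X w, Y w)) \<in> borel_measurable P"
    by (intro borel_measurable_Pair X_measurable Y_measurable)
  show mXY: "(\<lambda>w. (X w, Y w)) \<in> measurable P (restrict_space borel ?Q)"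
    using XY XY_range by (intro measurable_restrict_space2) auto
  have rect: "measure ?M ({0..x} \<times> {0..y}) = archimedean_copula \<phi> x y"
    if "x \<in> {0..1}" "y \<in> {0..1}" for x y
  proof -
    have "{0..x} \<times> {0..y} \<in> sets borel" by (intro borel_closed closed_Times) auto
    then have "{0..x} \<times> {0..y} \<in> sets (restrict_space borel ?Q)"
      using that by (subst sets_restrict_space_iff) (auto intro!: borel_closed closed_Times)
    then have "measure ?M ({0..x} \<times> {0..y}) = measure P ((\<lambda>w. (X w, Y w)) -` ({0..x} \<times> {0..y}) \<inter> space P)"
      by (rule measure_distr[OF mXY])
    also have "(\<lambda>w. (X w, Y w)) -` ({0..x} \<times> {0..y}) \<inter> space P = {w. X w \<le> x \<and> Y w \<le> y}"
      using XY_range by (auto simp: space_P)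
    finally show ?thesis using joint_distribution[OF that] by simp
  qed
  have M: "prob_space ?M" by (rule prob_space_distr[OF mXY])
  show "copula_measure (archimedean_copula \<phi>) = ?M"
    unfolding copula_measure_def
  proof (rule the_equality)
    show "prob_space ?M \<and> sets ?M = sets (restrict_space borel ?Q) \<and>
      (\<forall>x\<in>{0..1}. \<forall>y\<in>{0..1}. measure ?M ({0..x} \<times> {0..y}) = archimedean_copula \<phi> x y)"
      using M rect by simp
    fix N :: "(real \<times> real) measure"
    assume "prob_space N \<and> sets N = sets (restrict_space borel ?Q) \<and>
      (\<forall>x\<in>{0..1}. \<forall>y\<in>{0..1}. measure N ({0..x} \<times> {0..y}) = archimedean_copula \<phi> x y)"
    then show "N = ?M" using M rect by (intro measure_unit_square_eqI) auto
  qed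
qed

lemma copula_measurable:
  "(\<lambda>(x, y). archimedean_copula \<phi> x y) \<in> borel_measurable (restrict_space borel ({0..1} \<times> {0..1}))"
proof -
  have "(\<lambda>z :: real \<times> real. \<psi> (R (fst z) + R (snd z))) \<in> borel_measurable (borel \<Otimes>\<^sub>M borel)"
    by measurable
  then have "(\<lambda>z :: real \<times> real. \<psi> (R (fst z) + R (snd z))) \<in> borel_measurable (restrict_space borel ({0..1} \<times> {0..1}))"
    by (intro measurable_restrict_space1) (simp add: borel_prod)
  then show ?thesis
    by (rule measurable_cong[THEN iffD1, rotated])
      (auto simp: space_restrict_space archimedean_copula_def R_def to_unit_def)
qed

proposition kendall_eq_tangent_zero:
  assumes x: "0 < x" "x < 1"
  shows "kendall (archimedean_copula \<phi>) x = tangent_zero x"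
proof -
  let ?C = "\<lambda>(x, y). archimedean_copula \<phi> x y"
  have m: "(\<lambda>w. ?C (X w, Y w)) \<in> borel_measurable P"
    using measurable_compose[OF XY_measurable copula_measurable] by simp
  have "kendall (archimedean_copula \<phi>) x = measure (distr P borel (\<lambda>w. ?C (X w, Y w))) {..x}"
    unfolding kendall_def cdf_def copula_measure_eq
    by (subst distr_distr[OF copula_measurable XY_measurable]) (simp add: comp_def)
  also have "\<dots> = measure P {w. ?C (X w, Y w) \<le> x}"
    using m by (subst measure_distr) (auto simp: space_P vimage_def)
  also have "\<dots> = measure P ({..x} \<times> UNIV)"
  proof (rule measure_eq_AE)
    have "AE s in \<nu>. s \<in> {0..1}"
      unfolding \<nu>_def by (rule AE_uniform_measureI) auto
    then have "AE w in P. snd w \<in> {0..1}"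
      unfolding P_def
    proof (intro P.AE_pair_measure)
      show "{w \<in> space (\<mu> \<Otimes>\<^sub>M \<nu>). snd w \<in> {0..1}} \<in> sets (\<mu> \<Otimes>\<^sub>M \<nu>)" by measurable
    qed simp
    then show "AE w in P. w \<in> {w. ?C (X w, Y w) \<le> x} \<longleftrightarrow> w \<in> {..x} \<times> UNIV"
    proof eventually_elim
      case (elim w)
      obtain t s where w: "w = (t, s)" by (cases w)
      then have "?C (X w, Y w) = to_unit t" using elim copula_XY[of s t] by simp
      then show ?case using x by (auto simp: w to_unit_def)
    qed
    have "{w \<in> space P. ?C (X w, Y w) \<le> x} \<in> sets P" using m by measurable
    then show "{w. ?C (X w, Y w) \<le> x} \<in> sets P" by (simp add: space_P)
    show "{..x} \<times> UNIV \<in> sets P" by (simp add: sets_P)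
  qed
  also have "\<dots> = measure \<mu> {..x} * measure \<nu> UNIV"
    unfolding P_def measure_def by (subst \<nu>.emeasure_pair_measure_Times) (auto simp: enn2real_mult)
  also have "\<dots> = tangent_zero x"
    using \<nu>.prob_space kendall_cdf_eq_tangent_zero[OF x] by (simp add: measure_\<mu>_atMost)
  finally show ?thesis .
qed

end

section \<open>Convergence of sequences of generators and copulas\<close>

text \<open>
  Both inequalities have to be strict because only strict inequalities persist along the sequence; hence the gap of 2.
\<close>

lemma nat_between: "0 < r \<Longrightarrow> \<exists>k::nat. real k < r \<and> r < real k + 2"
  by (rule exI[of _ "nat (\<lceil>r\<rceil> - 1)"]) (auto simp: of_nat_nat; linarith)

locale generator_sequence =
  fixes \<phi> :: "real \<Rightarrow> ennreal" and \<phi>n :: "nat \<Rightarrow> real \<Rightarrow> ennreal"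
  assumes limit_generator: "generator \<phi>" and seq_generator: "\<And>n. generator (\<phi>n n)"
begin

sublocale limit: archimedean_generator \<phi>
  by standard (rule limit_generator)

sublocale seq: archimedean_generator "\<phi>n n" for n
  by standard (rule seq_generator)

definition f_converges :: bool where
  "f_converges \<longleftrightarrow> (\<forall>x\<in>{0<..1}. (\<lambda>n. seq.f n x) \<longlonglongrightarrow> limit.f x)"

definition D_converges :: bool where
  "D_converges \<longleftrightarrow> (\<forall>x\<in>cont_points limit.D. (\<lambda>n. seq.D n x) \<longlonglongrightarrow> limit.D x)"

definition G_converges :: bool where
  "G_converges \<longleftrightarrow> (\<forall>x\<in>cont_points limit.D. (\<lambda>n. seq.tangent_zero n x) \<longlonglongrightarrow> limit.tangent_zero x)"

definition C_converges :: bool where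
  "C_converges \<longleftrightarrow> (\<forall>x\<in>{0..1}. \<forall>y\<in>{0..1}.
     (\<lambda>n. archimedean_copula (\<phi>n n) x y) \<longlonglongrightarrow> archimedean_copula \<phi> x y)"

lemma f_convergesI:
  assumes "\<And>x. 0 < x \<Longrightarrow> x < 1 \<Longrightarrow> (\<lambda>n. seq.f n x) \<longlonglongrightarrow> limit.f x"
  shows f_converges
  unfolding f_converges_def
proof
  fix x :: real assume "x \<in> {0<..1}"
  then show "(\<lambda>n. seq.f n x) \<longlonglongrightarrow> limit.f x"
    using assms[of x] by (cases "x = 1") (simp_all add: limit.f_1 seq.f_1)
qed

lemma phi_converges_iff: "(\<forall>x\<in>{0<..1}. (\<lambda>n. \<phi>n n x) \<longlonglongrightarrow> \<phi> x) \<longleftrightarrow> f_converges"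
proof -
  have "((\<lambda>n. \<phi>n n x) \<longlonglongrightarrow> \<phi> x) \<longleftrightarrow> (\<lambda>n. seq.f n x) \<longlonglongrightarrow> limit.f x" if "x \<in> {0<..1}" for x
    using that limit.phi_eq_f[of x] seq.phi_eq_f[of x] by (simp add: tendsto_ennreal_iff)
  then show ?thesis unfolding f_converges_def by blast
qed

text \<open>
  For \<open>w < x < y\<close> the derivatives at \<open>x\<close> lie between the chord slopes over \<open>[w, x]\<close> and \<open>[x, y]\<close>. These slopes converge, and
  for the limit generator they approach \<open>D x\<close>: on the right always, on the left because \<open>D\<close> is continuous at \<open>x\<close>.
\<close>

lemma f_converges_imp_D_converges:
  assumes f_converges
  shows D_converges
  unfolding D_converges_def
proof
  fix x assume x: "x \<in> cont_points limit.D"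
  then have x01: "0 < x" "x < 1" and cont: "isCont limit.D x" by (auto simp: cont_points_def)
  have slope: "(\<lambda>n. seq.slope n u v) \<longlonglongrightarrow> limit.slope u v" if "0 < u" "u < v" "v \<le> 1" for u v
    unfolding limit.slope_def seq.slope_def
    using assms that by (intro tendsto_intros) (auto simp: f_converges_def)
  show "(\<lambda>n. seq.D n x) \<longlonglongrightarrow> limit.D x"
  proof (rule order_tendstoI)
    fix a assume a: "a < limit.D x"
    have "(limit.D \<longlongrightarrow> limit.D x) (at_left x)"
      using tendsto_within_subset[OF isContD[OF cont] subset_UNIV] .
    from order_tendstoD(1)[OF this a] eventually_at_left_real[OF x01(1)]
    have "eventually (\<lambda>w. a < limit.D w \<and> w \<in> {0<..<x}) (at_left x)"
      by (rule eventually_conj)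
    then obtain w where w: "a < limit.D w" "0 < w" "w < x"
      using eventually_happens trivial_limit_at_left_real by force
    have "a < limit.slope w x" using limit.D_le_slope[of w x] w x01 by simp
    from order_tendstoD(1)[OF slope this] w x01
    have "eventually (\<lambda>n. a < seq.slope n w x) sequentially" by simp
    then show "eventually (\<lambda>n. a < seq.D n x) sequentially"
    proof eventually_elim
      case (elim n)
      then show ?case using seq.slope_le_D[of w x n] w x01 by simp
    qed
  next
    fix a assume a: "limit.D x < a"
    from order_tendstoD(2)[OF limit.slope_tendsto[OF x01] a] eventually_at_right_real[OF x01(2)]
    have "eventually (\<lambda>y. limit.slope x y < a \<and> y \<in> {x<..<1}) (at_right x)"
      by (rule eventually_conj)
    then obtain y where y: "limit.slope x y < a" "x < y" "y < 1"
      using eventually_happens trivial_limit_at_right_real by force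
    from order_tendstoD(2)[OF slope y(1)] y x01
    have "eventually (\<lambda>n. seq.slope n x y < a) sequentially" by simp
    then show "eventually (\<lambda>n. seq.D n x < a) sequentially"
    proof eventually_elim
      case (elim n)
      then show ?case using seq.D_le_slope[of x y n] y x01 by simp
    qed
  qed
qed

lemma f_converges_imp_G_converges:
  assumes f_converges
  shows G_converges
  unfolding G_converges_def
proof
  fix x assume x: "x \<in> cont_points limit.D"
  then have x01: "0 < x" "x < 1" by (auto simp: cont_points_def)
  have "(\<lambda>n. seq.D n x) \<longlonglongrightarrow> limit.D x"
    using f_converges_imp_D_converges[OF assms] x by (simp add: D_converges_def)
  moreover have "(\<lambda>n. seq.f n x) \<longlonglongrightarrow> limit.f x"
    using assms x01 by (simp add: f_converges_def)
  ultimately show "(\<lambda>n. seq.tangent_zero n x) \<longlonglongrightarrow> limit.tangent_zero x"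
    unfolding limit.tangent_zero_def seq.tangent_zero_def
    using limit.D_neg[OF x01] by (intro tendsto_intros) auto
qed

text \<open>
  Integrate \<open>D\<close> from \<open>x\<close> to 1. By monotonicity the derivative at a single continuity point \<open>a < x\<close> bounds all derivatives
  on \<open>(x, 1)\<close>.
\<close>

lemma D_converges_imp_f_converges:
  assumes D_converges
  shows f_converges
proof (rule f_convergesI)
  fix x :: real assume x: "0 < x" "x < 1"
  obtain a where a: "0 < a" "a < x" "a \<in> cont_points limit.D"
    using limit.cont_point_between[of 0 x] x by auto
  have "(\<lambda>n. seq.f n 1 - seq.f n x) \<longlonglongrightarrow> limit.f 1 - limit.f x"
  proof (rule bounded_convergence_increments[OF seq.f_has_integral limit.f_has_integral limit.D_discontinuities_countable])
    show "(\<lambda>n. seq.D n s) \<longlonglongrightarrow> limit.D s" if "s \<in> {x<..<1} - ({0<..<1} - cont_points limit.D)" for s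
      using assms that x by (auto simp: D_converges_def)
    have "(\<lambda>n. seq.D n a) \<longlonglongrightarrow> limit.D a" using assms a by (simp add: D_converges_def)
    from order_tendstoD(1)[OF this, of "limit.D a - 1"]
    have "eventually (\<lambda>n. limit.D a - 1 < seq.D n a) sequentially" by simp
    then show "eventually (\<lambda>n. \<forall>s\<in>{x<..<1}. \<bar>seq.D n s\<bar> \<le> 1 - limit.D a) sequentially"
    proof eventually_elim
      case (elim n)
      show ?case
      proof
        fix s assume "s \<in> {x<..<1}"
        then show "\<bar>seq.D n s\<bar> \<le> 1 - limit.D a"
          using seq.D_mono[of a s n] seq.D_neg[of s n] elim a x by simp
      qed
    qed
  qed (use x in auto)
  from tendsto_minus[OF this] show "(\<lambda>n. seq.f n x) \<longlonglongrightarrow> limit.f x"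
    by (simp add: limit.f_1 seq.f_1)
qed

lemma (in archimedean_generator) log_derivative_eq: "0 < s \<Longrightarrow> s < 1 \<Longrightarrow> D s / f s = - (1 / (tangent_zero s - s))"
  using f_pos[of s] D_neg[of s] by (simp add: tangent_zero_def)

lemma (in archimedean_generator) tangent_zero_minus_id_lower_bound:
  assumes "0 < a" "b < 1"
  obtains d where "0 < d" "\<And>s. s \<in> {a..b} \<Longrightarrow> s + d \<le> tangent_zero s"
proof (cases "a \<le> b")
  case True
  have ab: "0 < f b" "D a < 0" using f_pos[of b] D_neg[of a] True assms by auto
  show ?thesis
  proof
    show "0 < f b / - D a" using ab by (intro divide_pos_pos) auto
    fix s assume s: "s \<in> {a..b}"
    have "f b / - D a \<le> f s / - D s"
      using s assms ab f_antimono[of s b] D_mono[of a s] D_neg[of s] by (intro frac_le) auto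
    then show "s + f b / - D a \<le> tangent_zero s" by (simp add: tangent_zero_def)
  qed
qed (use that[of 1] in auto)

text \<open>
  The integrand \<open>1 / (K s - s)\<close> needs a bound that is uniform in \<open>n\<close>. The limit satisfies \<open>s + d \<le> K s\<close> on a compact
  interval. Finitely many continuity points \<open>q\<close> have the property that every \<open>s\<close> lies less than \<open>d/3\<close> to the right of one of them, and since all
  functions \<open>K\<^sub>n\<close> increase, closeness of \<open>K\<^sub>n\<close> to \<open>K\<close> at these points suffices.
\<close>

lemma tangent_zero_minus_id_eventually_bounded_below:
  assumes G_converges "0 < a" "b < 1"
  obtains d where "0 < d" "eventually (\<lambda>n. \<forall>s\<in>{a..b}. s + d \<le> seq.tangent_zero n s) sequentially"
proof -
  obtain d where d: "0 < d" "\<And>s. s \<in> {a/2..b} \<Longrightarrow> s + d \<le> limit.tangent_zero s"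
    using limit.tangent_zero_minus_id_lower_bound[of "a/2" b] assms by auto
  \<comment> \<open>Points left of a are included, because the covering intervals extend only to the right of q.\<close>
  let ?T = "cont_points limit.D \<inter> {a/2..b}"
  have "{a..b} \<subseteq> (\<Union>q\<in>?T. {q<..<q + d/3})"
  proof
    fix s assume s: "s \<in> {a..b}"
    have "0 \<le> max (a/2) (s - d/3)" "max (a/2) (s - d/3) < s" "s \<le> 1" using s assms d(1) by auto
    then obtain q where "max (a/2) (s - d/3) < q" "q < s" "q \<in> cont_points limit.D"
      by (rule limit.cont_point_between)
    then show "s \<in> (\<Union>q\<in>?T. {q<..<q + d/3})" using s by (intro UN_I[of q]) auto
  qed
  then obtain Q where Q: "Q \<subseteq> ?T" "finite Q" "{a..b} \<subseteq> (\<Union>q\<in>Q. {q<..<q + d/3})"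
    by (rule compactE_image[OF compact_Icc, rotated]) auto
  have "eventually (\<lambda>n. \<forall>q\<in>Q. limit.tangent_zero q - d/3 < seq.tangent_zero n q) sequentially"
  proof (intro eventually_ball_finite Q(2) ballI)
    fix q assume "q \<in> Q"
    then have "(\<lambda>n. seq.tangent_zero n q) \<longlonglongrightarrow> limit.tangent_zero q" using Q(1) assms(1) by (auto simp: G_converges_def)
    from order_tendstoD(1)[OF this, of "limit.tangent_zero q - d/3"] d(1)
    show "eventually (\<lambda>n. limit.tangent_zero q - d/3 < seq.tangent_zero n q) sequentially" by simp
  qed
  then have "eventually (\<lambda>n. \<forall>s\<in>{a..b}. s + d/3 \<le> seq.tangent_zero n s) sequentially"
  proof eventually_elim
    case (elim n)
    show ?case
    proof
      fix s assume s: "s \<in> {a..b}"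
      then obtain q where q: "q \<in> Q" "q < s" "s < q + d/3" using Q(3) by auto
      have "q + d \<le> limit.tangent_zero q" "a/2 \<le> q" using d(2)[of q] q Q(1) by auto
      moreover have "seq.tangent_zero n q \<le> seq.tangent_zero n s"
        using seq.tangent_zero_mono[of q s n] q s assms \<open>a/2 \<le> q\<close> by simp
      ultimately show "s + d/3 \<le> seq.tangent_zero n s" using elim q by fastforce
    qed
  qed
  then show thesis using that[of "d/3"] d(1) by simp
qed

lemma G_converges_imp_ln_f_increments:
  assumes G_converges "0 < a" "a < b" "b < 1"
  shows "(\<lambda>n. ln (seq.f n b) - ln (seq.f n a)) \<longlonglongrightarrow> ln (limit.f b) - ln (limit.f a)"
proof -
  obtain d where d: "0 < d" "eventually (\<lambda>n. \<forall>s\<in>{a..b}. s + d \<le> seq.tangent_zero n s) sequentially"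
    using tangent_zero_minus_id_eventually_bounded_below[of a b] assms by auto
  show ?thesis
  proof (rule bounded_convergence_increments[OF seq.ln_f_has_integral limit.ln_f_has_integral limit.D_discontinuities_countable])
    fix s assume s: "s \<in> {a<..<b} - ({0<..<1} - cont_points limit.D)"
    then have s01: "0 < s" "s < 1" using assms by auto
    have "(\<lambda>n. seq.tangent_zero n s) \<longlonglongrightarrow> limit.tangent_zero s" using assms s s01 by (auto simp: G_converges_def)
    then have "(\<lambda>n. - (1 / (seq.tangent_zero n s - s))) \<longlonglongrightarrow> - (1 / (limit.tangent_zero s - s))"
      using limit.tangent_zero_greater[OF s01] by (intro tendsto_intros) auto
    then show "(\<lambda>n. seq.D n s / seq.f n s) \<longlonglongrightarrow> limit.D s / limit.f s"
      by (simp only: limit.log_derivative_eq[OF s01] seq.log_derivative_eq[OF s01])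
  next
    from d(2) show "eventually (\<lambda>n. \<forall>s\<in>{a<..<b}. \<bar>seq.D n s / seq.f n s\<bar> \<le> 1 / d) sequentially"
    proof eventually_elim
      case (elim n)
      show ?case
      proof
        fix s assume s: "s \<in> {a<..<b}"
        then have s01: "0 < s" "s < 1" using assms by auto
        have "s + d \<le> seq.tangent_zero n s" using elim s by simp
        then have "d \<le> seq.tangent_zero n s - s" by linarith
        then show "\<bar>seq.D n s / seq.f n s\<bar> \<le> 1 / d"
          using d(1) by (simp add: seq.log_derivative_eq[OF s01] frac_le)
      qed
    qed
  qed (use assms in auto)
qed

lemma G_converges_imp_f_converges:
  assumes G_converges
  shows f_converges
proof (rule f_convergesI)
  fix x :: real assume x: "0 < x" "x < 1"
  have "(\<lambda>n. ln (seq.f n x)) \<longlonglongrightarrow> ln (limit.f x)"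
  proof (cases x "1/2 :: real" rule: linorder_cases)
    case less
    from tendsto_minus[OF G_converges_imp_ln_f_increments[OF assms x(1) less]] show ?thesis
      by (simp add: limit.f_half seq.f_half)
  next
    case equal
    then show ?thesis unfolding equal by (simp only: limit.f_half seq.f_half tendsto_const)
  next
    case greater
    from G_converges_imp_ln_f_increments[OF assms _ greater x(2)] show ?thesis
      by (simp add: limit.f_half seq.f_half)
  qed
  from tendsto_exp[OF this] show "(\<lambda>n. seq.f n x) \<longlonglongrightarrow> limit.f x"
    using limit.f_pos[OF x] seq.f_pos[OF x] by simp
qed

text \<open>
  The copula value lies above or below a level \<open>t\<close> according to a strict inequality between \<open>f x + f y\<close> and \<open>f t\<close>, which is
  stable under convergence of the generators.
\<close>

lemma f_converges_imp_C_converges: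
  assumes f: f_converges
  shows C_converges
  unfolding C_converges_def
proof (intro ballI)
  fix x y :: real assume xy: "x \<in> {0..1}" "y \<in> {0..1}"
  let ?C = "archimedean_copula \<phi> x y" and ?Cn = "\<lambda>n. archimedean_copula (\<phi>n n) x y"
  show "?Cn \<longlonglongrightarrow> ?C"
  proof (cases "x = 0 \<or> y = 0")
    case True
    then show ?thesis using limit.copula_0 seq.copula_0 by auto
  next
    case False
    with xy have xy': "x \<in> {0<..1}" "y \<in> {0<..1}" by auto
    have sum: "(\<lambda>n. seq.f n x + seq.f n y) \<longlonglongrightarrow> limit.f x + limit.f y"
      using f xy' by (intro tendsto_add) (auto simp: f_converges_def)
    have ft: "(\<lambda>n. seq.f n t) \<longlonglongrightarrow> limit.f t" if "t \<in> {0<..1}" for t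
      using f that by (simp add: f_converges_def)
    show ?thesis
    proof (rule order_tendstoI)
      fix a assume a: "a < ?C"
      show "eventually (\<lambda>n. a < ?Cn n) sequentially"
      proof (cases "a < 0")
        case True
        then have "a < ?Cn n" for n using seq.copula_range[of n x y] by simp
        then show ?thesis by simp
      next
        case False
        obtain t where t: "a < t" "t < ?C" using dense[OF a] by blast
        with False have t01: "t \<in> {0<..1}" using limit.copula_range[of x y] by simp
        have "limit.f x + limit.f y < limit.f t"
          using limit.copula_less_iff(2)[OF xy' t01] t by simp
        from order_tendstoD(1)[OF tendsto_diff[OF ft[OF t01] sum], of 0] this
        have "eventually (\<lambda>n. 0 < seq.f n t - (seq.f n x + seq.f n y)) sequentially" by simp
        then show ?thesis
        proof eventually_elim
          case (elim n)
          then show ?case using seq.copula_less_iff(2)[OF xy' t01, of n] t by simp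
        qed
      qed
    next
      fix a assume a: "?C < a"
      show "eventually (\<lambda>n. ?Cn n < a) sequentially"
      proof (cases "1 < a")
        case True
        then have "?Cn n < a" for n using seq.copula_range[of n x y] by simp
        then show ?thesis by simp
      next
        case False
        have a01: "a \<in> {0<..1}" using False a limit.copula_range[of x y] by simp
        have "limit.f a < limit.f x + limit.f y"
          using limit.copula_less_iff(1)[OF xy' a01] a by simp
        from order_tendstoD(1)[OF tendsto_diff[OF sum ft[OF a01]], of 0] this
        have "eventually (\<lambda>n. 0 < seq.f n x + seq.f n y - seq.f n a) sequentially" by simp
        then show ?thesis
        proof eventually_elim
          case (elim n)
          then show ?case using seq.copula_less_iff(1)[OF xy' a01, of n] by simp
        qed
      qed
    qed
  qed
qed

lemma (in archimedean_generator) f_surj: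
  assumes "0 \<le> v" "v < f t" "t \<in> {0<..1}"
  obtains s where "s \<in> {0<..1}" "f s = v"
proof -
  have "ennreal v < ennreal (f t)" using assms by (intro ennreal_lessI) auto
  also have "\<dots> = \<phi> t" using assms by (simp add: phi_eq_f)
  also have "\<dots> \<le> \<phi> 0" using assms phi_le_iff[of t 0] by simp
  finally obtain s where s: "0 < s" "s \<le> 1" "\<phi> s = ennreal v" by (rule phi_surj_pos)
  have "f s = v" unfolding f_def s(3) using assms by simp
  then show thesis using that[of s] s by simp
qed

lemma copula_comparisons_persist:
  assumes C_converges and syt: "s \<in> {0<..1}" "y \<in> {0<..1}" "t \<in> {0<..1}"
  shows "limit.f s + limit.f y < limit.f t \<Longrightarrow> eventually (\<lambda>n. seq.f n s + seq.f n y < seq.f n t) sequentially"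
    and "limit.f t < limit.f s + limit.f y \<Longrightarrow> eventually (\<lambda>n. seq.f n t < seq.f n s + seq.f n y) sequentially"
proof -
  have C: "(\<lambda>n. archimedean_copula (\<phi>n n) s y) \<longlonglongrightarrow> archimedean_copula \<phi> s y"
    using assms by (auto simp: C_converges_def)
  show "eventually (\<lambda>n. seq.f n s + seq.f n y < seq.f n t) sequentially" if "limit.f s + limit.f y < limit.f t"
  proof -
    have "t < archimedean_copula \<phi> s y" using that limit.copula_less_iff(2)[OF syt] by blast
    from order_tendstoD(1)[OF C this] show ?thesis by (simp only: seq.copula_less_iff(2)[OF syt])
  qed
  show "eventually (\<lambda>n. seq.f n t < seq.f n s + seq.f n y) sequentially" if "limit.f t < limit.f s + limit.f y"
  proof -
    have "archimedean_copula \<phi> s y < t" using that limit.copula_less_iff(1)[OF syt] by blast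
    from order_tendstoD(2)[OF C this] show ?thesis by (simp only: seq.copula_less_iff(1)[OF syt])
  qed
qed

text \<open>
  In the induction step a point \<open>s\<close> with \<open>k * f y < f s < f t - f y\<close> splits the inequality into one about \<open>k\<close> multiples and one
  that compares \<open>C s y\<close> with \<open>t\<close>.
\<close>

lemma multiple_less_persists:
  assumes C: C_converges and y: "y \<in> {0<..1}"
  shows "t \<in> {0<..1} \<Longrightarrow> real k * limit.f y < limit.f t \<Longrightarrow>
    eventually (\<lambda>n. real k * seq.f n y < seq.f n t) sequentially"
proof (induction k arbitrary: t)
  case 0
  then have "t \<noteq> 1" using limit.f_1 by auto
  then show ?case using 0 seq.f_pos[of t] by simp
next
  case (Suc k)
  have less: "real k * limit.f y < limit.f t - limit.f y" using Suc.prems by (simp add: distrib_right)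
  then obtain v where v: "real k * limit.f y < v" "v < limit.f t - limit.f y" using dense by blast
  have "0 \<le> v" using v(1) by (smt (verit) limit.f_nonneg mult_nonneg_nonneg of_nat_0_le_iff)
  moreover have "v < limit.f t" using v(2) limit.f_nonneg[of y] by linarith
  ultimately obtain s where s: "s \<in> {0<..1}" "limit.f s = v"
    using Suc.prems by (auto elim: limit.f_surj)
  have "eventually (\<lambda>n. real k * seq.f n y < seq.f n s) sequentially"
    using Suc.IH[OF s(1)] s(2) v(1) by simp
  moreover have "eventually (\<lambda>n. seq.f n s + seq.f n y < seq.f n t) sequentially"
    using copula_comparisons_persist(1)[OF C s(1) y Suc.prems(1)] s(2) v(2) by simp
  ultimately show ?case by eventually_elim (simp add: distrib_right)
qed

text \<open>
  As before, with \<open>f t - f y < f s < k * f y\<close>. Such a point exists only if \<open>f t \<ge> f y\<close>; otherwise \<open>y < t\<close>, and monotonicity of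
  the generators suffices.
\<close>

lemma less_multiple_persists:
  assumes C: C_converges and y: "y \<in> {0<..1}"
  shows "t \<in> {0<..1} \<Longrightarrow> limit.f t < real k * limit.f y \<Longrightarrow>
    eventually (\<lambda>n. seq.f n t < real k * seq.f n y) sequentially"
proof (induction k arbitrary: t)
  case 0
  then show ?case using limit.f_nonneg[of t] by (simp add: not_less[symmetric])
next
  case (Suc k)
  show ?case
  proof (cases "limit.f t < limit.f y")
    case True
    then have "y < t" using limit.f_less_iff[of t y] Suc.prems y by simp
    have "seq.f n t < real (Suc k) * seq.f n y" for n
    proof -
      have "seq.f n t < 1 * seq.f n y" using \<open>y < t\<close> seq.f_strict[of y t n] Suc.prems y by simp
      also have "\<dots> \<le> real (Suc k) * seq.f n y" by (intro mult_right_mono) auto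
      finally show ?thesis .
    qed
    then show ?thesis by (intro always_eventually allI)
  next
    case False
    have "limit.f y \<noteq> 0" using Suc.prems(2) limit.f_nonneg[of t] by (metis mult_zero_right not_less)
    then have "0 < limit.f y" by (simp add: order_less_le)
    then have "limit.f t - limit.f y < min (real k * limit.f y) (limit.f t)"
      using Suc.prems(2) by (simp add: distrib_right)
    then obtain v where v: "limit.f t - limit.f y < v" "v < min (real k * limit.f y) (limit.f t)"
      using dense by blast
    have "0 \<le> v" "v < limit.f t" using False v by auto
    then obtain s where s: "s \<in> {0<..1}" "limit.f s = v"
      using Suc.prems by (auto elim: limit.f_surj)
    have "eventually (\<lambda>n. seq.f n s < real k * seq.f n y) sequentially"
      using Suc.IH[OF s(1)] s(2) v(2) by simp
    moreover have "eventually (\<lambda>n. seq.f n t < seq.f n s + seq.f n y) sequentially"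
      using copula_comparisons_persist(2)[OF C s(1) y Suc.prems(1)] s(2) v(1) by simp
    ultimately show ?thesis by eventually_elim (simp add: distrib_right)
  qed
qed

text \<open>
  Choose \<open>y\<close> with \<open>f y = e\<close>. The numbers \<open>m\<close> and \<open>k\<close> count how often \<open>e\<close> fits into \<open>f (1/2) = 1\<close> and into \<open>f x\<close>, with
  an error less than 2. The same counts are eventually valid for \<open>f\<^sub>n\<close>, so \<open>f\<^sub>n x\<close> lies between \<open>k / (m + 2)\<close> and
  \<open>(k + 2) / m\<close>, although nothing is known yet about \<open>f\<^sub>n y\<close>. Both quotients are close to \<open>f x\<close> for small \<open>e\<close>.
\<close>

lemma C_converges_imp_sandwich:
  assumes C: C_converges and x: "0 < x" "x < 1" and e: "0 < e" "e < 1/2"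
  shows "eventually (\<lambda>n. (limit.f x - 2 * e) / (1 + 2 * e) < seq.f n x \<and>
     seq.f n x < (limit.f x + 2 * e) / (1 - 2 * e)) sequentially"
proof -
  have half: "1/2 \<in> {0<..1 :: real}" and x': "x \<in> {0<..1}" using x by auto
  obtain y where y: "y \<in> {0<..1}" "limit.f y = e"
    using limit.f_surj[of e "1/2"] e limit.f_half by auto
  obtain m where m: "real m < 1 / e" "1 / e < real m + 2" using nat_between[of "1/e"] e by auto
  obtain k where k: "real k < limit.f x / e" "limit.f x / e < real k + 2"
    using nat_between[of "limit.f x / e"] e limit.f_pos[OF x] by auto
  have m': "real m * e < 1" "1 < real (m + 2) * e" using m e by (simp_all add: field_simps)
  have k': "real k * e < limit.f x" "limit.f x < real (k + 2) * e" using k e by (simp_all add: field_simps)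
  have "eventually (\<lambda>n. real m * seq.f n y < 1) sequentially"
    using multiple_less_persists[OF C y(1) half] m' y by (simp add: limit.f_half seq.f_half)
  moreover have "eventually (\<lambda>n. 1 < real (m + 2) * seq.f n y) sequentially"
    using less_multiple_persists[OF C y(1) half, of "m + 2"] m' y by (simp add: limit.f_half seq.f_half)
  moreover have "eventually (\<lambda>n. real k * seq.f n y < seq.f n x) sequentially"
    using multiple_less_persists[OF C y(1) x'] k' y by simp
  moreover have "eventually (\<lambda>n. seq.f n x < real (k + 2) * seq.f n y) sequentially"
    using less_multiple_persists[OF C y(1) x', of "k + 2"] k' y by simp
  ultimately show ?thesis
  proof eventually_elim
    case (elim n)
    let ?F = "seq.f n x" and ?y = "seq.f n y"
    have F: "0 < ?F" using seq.f_pos[OF x] .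
    have "limit.f x - 2 * e < real k * e" using k' by (simp add: distrib_right)
    also have "\<dots> \<le> real k * (real (m + 2) * ?y) * e"
      using elim(2) e by (intro mult_right_mono mult_le_cancel_left1[THEN iffD2]) auto
    also have "\<dots> = (real k * ?y) * (real (m + 2) * e)" by simp
    also have "\<dots> \<le> ?F * (1 + 2 * e)"
      using elim(3) m' e F by (intro mult_mono) (auto simp: distrib_right)
    finally have lower: "limit.f x - 2 * e < ?F * (1 + 2 * e)" .
    have "?F * (1 - 2 * e) \<le> ?F * (real m * e)"
      using m' F by (intro mult_left_mono) (auto simp: distrib_right)
    also have "\<dots> \<le> (real (k + 2) * ?y) * (real m * e)"
      using elim(4) e by (intro mult_right_mono) auto
    also have "\<dots> = (real (k + 2) * e) * (real m * ?y)" by simp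
    also have "\<dots> \<le> (real (k + 2) * e) * 1"
      using elim(1) e by (intro mult_left_mono) auto
    also have "\<dots> < limit.f x + 2 * e" using k' by (simp add: distrib_right)
    finally have "?F * (1 - 2 * e) < limit.f x + 2 * e" .
    with lower show ?case using e by (simp add: pos_divide_less_eq pos_less_divide_eq)
  qed
qed

lemma C_converges_imp_f_converges:
  assumes C: C_converges
  shows f_converges
proof (rule f_convergesI)
  fix x :: real assume x: "0 < x" "x < 1"
  let ?A = "limit.f x"
  have small: "eventually (\<lambda>e. e \<in> {0<..<1/2}) (at_right (0::real))"
    by (rule eventually_at_right_real) simp
  have sandwich: "eventually (\<lambda>n. P (seq.f n x)) sequentially"
    if ev: "eventually (\<lambda>e. \<forall>z. (?A - 2 * e) / (1 + 2 * e) < z \<and> z < (?A + 2 * e) / (1 - 2 * e) \<longrightarrow> P z) (at_right 0)" for P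
  proof -
    obtain e where e: "0 < e" "e < 1/2" and P: "\<And>z. (?A - 2 * e) / (1 + 2 * e) < z \<Longrightarrow> z < (?A + 2 * e) / (1 - 2 * e) \<Longrightarrow> P z"
      using eventually_happens[OF eventually_conj[OF small ev]] by auto
    from C_converges_imp_sandwich[OF C x e] show ?thesis by eventually_elim (use P in blast)
  qed
  have lo: "((\<lambda>e. (?A - 2 * e) / (1 + 2 * e)) \<longlongrightarrow> (?A - 2 * 0) / (1 + 2 * 0)) (at_right 0)"
    by (intro tendsto_intros) auto
  have hi: "((\<lambda>e. (?A + 2 * e) / (1 - 2 * e)) \<longlongrightarrow> (?A + 2 * 0) / (1 - 2 * 0)) (at_right 0)"
    by (intro tendsto_intros) auto
  show "(\<lambda>n. seq.f n x) \<longlonglongrightarrow> ?A"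
  proof (rule order_tendstoI)
    fix a assume "a < ?A"
    then have "eventually (\<lambda>e. a < (?A - 2 * e) / (1 + 2 * e)) (at_right 0)"
      using order_tendstoD(1)[OF lo, of a] by simp
    then show "eventually (\<lambda>n. a < seq.f n x) sequentially"
      by (intro sandwich) (auto elim!: eventually_mono)
  next
    fix a assume "?A < a"
    then have "eventually (\<lambda>e. (?A + 2 * e) / (1 - 2 * e) < a) (at_right 0)"
      using order_tendstoD(2)[OF hi, of a] by simp
    then show "eventually (\<lambda>n. seq.f n x < a) sequentially"
      by (intro sandwich) (auto elim!: eventually_mono)
  qed
qed

lemma kendall_converges_iff:
  "(\<forall>x\<in>cont_points limit.D. (\<lambda>n. kendall (archimedean_copula (\<phi>n n)) x) \<longlonglongrightarrow> kendall (archimedean_copula \<phi>) x)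
    \<longleftrightarrow> G_converges"
  unfolding G_converges_def
  by (intro ball_cong refl) (simp add: cont_points_def limit.kendall_eq_tangent_zero seq.kendall_eq_tangent_zero)

end

theorem theorem4p1:
  fixes \<phi> :: "real \<Rightarrow> ennreal" and \<phi>n :: "nat \<Rightarrow> real \<Rightarrow> ennreal"
  assumes "generator \<phi>" and "\<And>n. generator (\<phi>n n)"
  shows
    "let C = archimedean_copula \<phi>;
         Cn = (\<lambda>n. archimedean_copula (\<phi>n n));
         a = (\<forall>x\<in>{0..1}. \<forall>y\<in>{0..1}. (\<lambda>n. Cn n x y) \<longlonglongrightarrow> C x y);
         b = (\<forall>x\<in>cont_points (right_deriv \<phi>). (\<lambda>n. kendall (Cn n) x) \<longlonglongrightarrow> kendall C x);
         c = (\<forall>x\<in>{0<..1}. (\<lambda>n. \<phi>n n x) \<longlonglongrightarrow> \<phi> x);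
         d = (\<forall>x\<in>cont_points (right_deriv \<phi>).
                (\<lambda>n. right_deriv (\<phi>n n) x) \<longlonglongrightarrow> right_deriv \<phi> x)
     in (a \<longleftrightarrow> b) \<and> (b \<longleftrightarrow> c) \<and> (c \<longleftrightarrow> d)"
proof -
  interpret generator_sequence \<phi> \<phi>n using assms by unfold_locales
  show ?thesis
    unfolding Let_def kendall_converges_iff phi_converges_iff
      C_converges_def[symmetric] D_converges_def[symmetric]
    using f_converges_imp_D_converges f_converges_imp_G_converges D_converges_imp_f_converges
      G_converges_imp_f_converges f_converges_imp_C_converges C_converges_imp_f_converges
    by blast
qed

end
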